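(* Let $n \ge 3$ and let $K_1, \ldots, K_n \subset \mathbb{R}^2$ be pairwise disjoint convex sets such that $S = \mathbb{R}^2 \setminus (\bigcup_{i=1}^n K_i)$ is finite. Then $|S| \le 5n - 11$. Furthermore, this bound is sharp: for every $n \ge 3$ there exist pairwise disjoint convex sets $K_1, \ldots, K_n \subset \mathbb{R}^2$ such that $\mathbb{R}^2 \setminus (\bigcup_{i=1}^n K_i)$ is finite and has exactly $5n-11$ elements.
   Context: The sets $K_i$ are arbitrary convex sets (not assumed open, closed or bounded). *)

theory Defs
  imports "HOL-Analysis.Analysis"
begin

end

theory Submission imports Defs begin

text \<open>
  Upper bound: sweep the plane by parallel lines in a generic direction, so that each line contains
  at most one point of $S$ and the leftmost and the rightmost set are the same on all lines. Let
  $c_-$ and $c_+$ be the numbers of sets that are unbounded below and above. A line at which some set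
  begins or ends is critical; there are at most $2n - c_- - c_+$ of these. A point of $S$ on
  a non-critical line is determined by its left and right neighbours, an adjacent pair. Passing
  upwards, adjacent pairs are only created when a set begins (at most two) or ends (at most one), so
  there are at most $(c_- - 1) + 2(n - c_-) + (n - c_+)$ of them. In total
  $|S| \<le> 5n - 1 - 2(c_- + c_+)$. Finally $c_- + c_+ \<ge> 5$, unless $S$ lies on a single line
  separating the leftmost from the rightmost set, and then $|S| \<le> n$.

  Sharpness: cut the region $|y| < f(x)$ by vertical segments, for a convex piecewise linear $f$ that
  vanishes for $x \<le> 0$. All vertices are missing, and on every edge the two neighbouring
  cells share the edge up to one missing point.
\<close>

subsection \<open>Adjacent pairs in finite linear orders\<close>

definition adj :: "('i \<Rightarrow> 'i \<Rightarrow> bool) \<Rightarrow> 'i set \<Rightarrow> ('i \<times> 'i) set" where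
  "adj R P = {(a, b). a \<in> P \<and> b \<in> P \<and> R a b \<and> \<not> (\<exists>k\<in>P. R a k \<and> R k b)}"

definition strict_linorder_on :: "'i set \<Rightarrow> ('i \<Rightarrow> 'i \<Rightarrow> bool) \<Rightarrow> bool" where
  "strict_linorder_on P R \<longleftrightarrow> asymp_on P R \<and> transp_on P R \<and> totalp_on P R"

lemma adj_subset: "adj R P \<subseteq> P \<times> P"
  by (auto simp: adj_def)

lemma adj_right_unique:
  assumes "strict_linorder_on P R" "(a, b) \<in> adj R P" "(a, c) \<in> adj R P"
  shows "b = c"
  using assms unfolding strict_linorder_on_def adj_def totalp_on_def by blast

lemma adj_left_unique:
  assumes "strict_linorder_on P R" "(a, c) \<in> adj R P" "(b, c) \<in> adj R P"
  shows "a = b"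
  using assms unfolding strict_linorder_on_def adj_def totalp_on_def by blast

text \<open>A pair is determined by its left member, and a maximal element of \<open>P\<close> is
  never a left member.\<close>

lemma card_adj:
  assumes R: "strict_linorder_on P R" and "finite P" "P \<noteq> {}"
  shows "card (adj R P) + 1 \<le> card P"
proof -
  have "\<exists>m\<in>P. \<forall>x\<in>P. \<not> R m x"
    using Finite_Set.bex_max_element[of P R] assms
    unfolding strict_linorder_on_def
    by (metis asymp_onD)
  then obtain m where m: "m \<in> P" "\<And>x. x \<in> P \<Longrightarrow> \<not> R m x" by blast
  have "inj_on fst (adj R P)"
    using adj_right_unique[OF R] by (auto simp: inj_on_def)
  moreover have "fst ` adj R P \<subseteq> P - {m}"
    using m by (auto simp: adj_def)
  ultimately have "card (adj R P) \<le> card (P - {m})"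
    using assms by (intro card_inj_on_le[of fst]) auto
  then show ?thesis
    using m assms by (metis Suc_eq_plus1 Suc_le_mono card.remove)
qed

text \<open>A pair that is new in \<open>Q\<close> is charged to its left member or its right member if that is new,
  and otherwise to an element of \<open>P\<close> that separated the two and has disappeared.\<close>

lemma card_adj_diff:
  assumes P: "strict_linorder_on P R" "finite P" and Q: "strict_linorder_on Q R" "finite Q"
  shows "card (adj R Q - adj R P) \<le> 2 * card (Q - P) + card (P - Q)"
proof -
  define X where "X = {(a, b) \<in> adj R Q. a \<in> Q - P}"
  define Y where "Y = {(a, b) \<in> adj R Q. b \<in> Q - P}"
  define Z where "Z = {(a, b) \<in> adj R Q - adj R P. a \<in> P \<and> b \<in> P}"
  have fin: "finite (adj R Q)" by (rule finite_subset[OF adj_subset]) (use Q in simp)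
  have X: "card X \<le> card (Q - P)"
    using adj_right_unique[OF Q(1)] Q
    by (intro card_inj_on_le[of fst]) (auto simp: X_def intro!: inj_onI)
  have Y: "card Y \<le> card (Q - P)"
    using adj_left_unique[OF Q(1)] Q
    by (intro card_inj_on_le[of snd]) (auto simp: Y_def intro!: inj_onI)
  have "\<forall>e\<in>Z. \<exists>k\<in>P. R (fst e) k \<and> R k (snd e)"
    by (auto simp: Z_def adj_def)
  then obtain f where f: "\<And>e. e \<in> Z \<Longrightarrow> f e \<in> P \<and> R (fst e) (f e) \<and> R (f e) (snd e)"
    by metis
  have f_PQ: "f e \<in> P - Q" if "e \<in> Z" for e
    using f[OF that] that by (auto simp: Z_def adj_def)
  have "inj_on f Z"
  proof (rule inj_onI)
    fix e e' assume e: "e \<in> Z" "e' \<in> Z" "f e = f e'"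
    obtain a b a' b' where eq: "e = (a, b)" "e' = (a', b')" by (cases e, cases e')
    have in_P: "a \<in> P" "b \<in> P" "a' \<in> P" "b' \<in> P" "f e \<in> P"
      using e f by (auto simp: Z_def eq)
    have adj: "(a, b) \<in> adj R Q" "(a', b') \<in> adj R Q"
      using e by (auto simp: Z_def eq)
    have "R a (f e)" "R (f e) b" "R a' (f e)" "R (f e) b'"
      using f[OF e(1)] f[OF e(2)] e(3) by (auto simp: eq)
    \<comment> \<open>Both pairs straddle the same \<open>f e\<close>, so transitivity in
      \<open>P\<close> puts each left member before both right members. Two different left or right
      members would then break adjacency in \<open>Q\<close>.\<close>
    then have "R a b'" "R a' b"
      using P(1) in_P unfolding strict_linorder_on_def by (meson transp_onD)+
    then have "a = a'" "b = b'"
      using adj Q(1) unfolding strict_linorder_on_def adj_def totalp_on_def by blast+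
    then show "e = e'" by (simp add: eq)
  qed
  then have Z: "card Z \<le> card (P - Q)"
    using f_PQ P by (intro card_inj_on_le[of f]) auto
  have "adj R Q - adj R P \<subseteq> X \<union> Y \<union> Z"
    by (auto simp: X_def Y_def Z_def adj_def)
  moreover have "finite (X \<union> Y \<union> Z)"
    by (rule finite_subset[OF _ fin]) (auto simp: X_def Y_def Z_def)
  ultimately have "card (adj R Q - adj R P) \<le> card (X \<union> Y \<union> Z)" by (rule card_mono[rotated])
  also have "\<dots> \<le> card X + card Y + card Z"
    by (meson card_Un_le le_trans add_le_mono1)
  finally show ?thesis using X Y Z by linarith
qed

subsection \<open>Sweeping a convex cover\<close>

lemma convex_horizontal:
  assumes "convex C" "(x1, y) \<in> C" "(x2, y) \<in> C" "x1 \<le> x" "x \<le> x2"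
  shows "(x, y::real) \<in> (C :: (real \<times> real) set)"
proof (cases "x1 = x2")
  case False
  define t where "t = (x - x1) / (x2 - x1)"
  have t: "0 \<le> t" "t \<le> 1" using assms False by (auto simp: t_def field_simps)
  have "(1 - t) *\<^sub>R (x1, y) + t *\<^sub>R (x2, y) \<in> C"
    using convexD_alt[OF assms(1-3) t] .
  moreover have "(1 - t) * x1 + t * x2 = x"
  proof -
    have "t * (x2 - x1) = x - x1" using False by (simp add: t_def)
    then show ?thesis by (simp add: algebra_simps)
  qed
  moreover have "(1 - t) * y + t * y = y" by (simp add: algebra_simps)
  ultimately show ?thesis by simp
qed (use assms in auto)

text \<open>Parametrising by the height \<open>y\<close> covers all non-horizontal lines, the
  vertical ones with \<open>m = 0\<close>.\<close>

lemma convex_oblique: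
  assumes "convex C" "(x0 + m * y1, y1) \<in> C" "(x0 + m * y2, y2) \<in> C" "y1 \<le> y" "y \<le> y2"
  shows "(x0 + m * y, y) \<in> (C :: (real \<times> real) set)"
proof (cases "y1 = y2")
  case False
  define t where "t = (y - y1) / (y2 - y1)"
  have t: "0 \<le> t" "t \<le> 1" using assms False by (auto simp: t_def field_simps)
  have in_C: "(1 - t) *\<^sub>R (x0 + m * y1, y1) + t *\<^sub>R (x0 + m * y2, y2) \<in> C"
    using convexD_alt[OF assms(1-3) t] .
  have y: "y = (1 - t) * y1 + t * y2"
  proof -
    have "t * (y2 - y1) = y - y1" using False by (simp add: t_def)
    then show ?thesis by (simp add: algebra_simps)
  qed
  have "x0 + m * y = (1 - t) * (x0 + m * y1) + t * (x0 + m * y2)"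
    unfolding y by (simp add: algebra_simps)
  then have "(x0 + m * y, y) = (1 - t) *\<^sub>R (x0 + m * y1, y1) + t *\<^sub>R (x0 + m * y2, y2)"
    using y by simp
  then show ?thesis using in_C by metis
qed (use assms in auto)

lemma convex_snd_between:
  assumes "convex (C :: (real \<times> real) set)" "y1 \<in> snd ` C" "y2 \<in> snd ` C" "y1 \<le> y" "y \<le> y2"
  shows "y \<in> snd ` C"
proof -
  have "convex (snd ` C)" using assms(1) by (intro convex_linear_image linear_snd)
  then have "is_interval (snd ` C)" by (simp add: is_interval_convex_1)
  then show ?thesis using assms(2-) unfolding is_interval_1 by blast
qed

text \<open>The strict inequality puts \<open>y - d\<close> and \<open>y + d\<close> outside
  \<open>F\<close>, with at most \<open>y\<close> itself from \<open>F\<close> between them. Sample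
  levels next to a critical level or a point of \<open>S\<close> are chosen in this way.\<close>

lemma finite_gap:
  fixes y :: real
  assumes "finite F"
  obtains d where "d > 0" "\<And>c. c \<in> F \<Longrightarrow> c \<noteq> y \<Longrightarrow> d < \<bar>c - y\<bar>"
proof -
  obtain d where "d > 0" "\<forall>c\<in>F. c \<noteq> y \<longrightarrow> d \<le> dist y c"
    using finite_set_avoid[OF assms] by blast
  then have "d / 2 < \<bar>c - y\<bar>" if "c \<in> F" "c \<noteq> y" for c
    using that by (fastforce simp: dist_real_def abs_minus_commute)
  then show ?thesis using \<open>d > 0\<close> that[of "d/2"] by simp
qed

text \<open>The sweep lines are the horizontals, and \<open>inj_snd_S\<close> is the genericity of
  their direction. A shear later reduces the general situation to this one.\<close>

locale convex_cover =
  fixes I :: "'i set" and K :: "'i \<Rightarrow> (real \<times> real) set" and S :: "(real \<times> real) set"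
  assumes finite_I: "finite I"
    and convex_K: "i \<in> I \<Longrightarrow> convex (K i)"
    and disjoint_K: "i \<in> I \<Longrightarrow> j \<in> I \<Longrightarrow> i \<noteq> j \<Longrightarrow> K i \<inter> K j = {}"
    and S_eq: "S = UNIV - (\<Union>i\<in>I. K i)"
    and finite_S: "finite S"
    and inj_snd_S: "inj_on snd S"
begin

section \<open>Order on a level and critical levels\<close>

definition left :: "'i \<Rightarrow> 'i \<Rightarrow> bool" where
  "left i j \<longleftrightarrow> i \<noteq> j \<and> (\<exists>x x' y. (x, y) \<in> K i \<and> (x', y) \<in> K j \<and> x < x')"

definition pres :: "real \<Rightarrow> 'i set" where
  "pres y = {i \<in> I. y \<in> snd ` K i}"

text \<open>The cardinalities of \<open>low\<close> and \<open>high\<close> are c_- and c_+ of the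
  overview.\<close>

definition low where "low = {i \<in> I. \<not> bdd_below (snd ` K i)}"
definition high where "high = {i \<in> I. \<not> bdd_above (snd ` K i)}"
text \<open>Empty sets contribute the arbitrary levels \<open>Inf {}\<close> and \<open>Sup {}\<close>; more critical levels do no harm,
  as only their number is bounded.\<close>

definition crit where
  "crit = (\<lambda>i. Inf (snd ` K i)) ` (I - low) \<union> (\<lambda>i. Sup (snd ` K i)) ` (I - high)"

lemma not_in_S: "i \<in> I \<Longrightarrow> p \<in> K i \<Longrightarrow> p \<notin> S"
  by (auto simp: S_eq)

lemma in_some: "p \<notin> S \<Longrightarrow> \<exists>i\<in>I. p \<in> K i"
  by (auto simp: S_eq)

lemma K_eqI: "p \<in> K i \<Longrightarrow> p \<in> K j \<Longrightarrow> i \<in> I \<Longrightarrow> j \<in> I \<Longrightarrow> i = j"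
  using disjoint_K by blast

text \<open>One witnessing level in \<open>left\<close> is enough: if the order were reversed on
  another common level, moving linearly between the two levels would make the sets meet.\<close>

lemma leftD:
  assumes "left i j" "i \<in> I" "j \<in> I" "(x, y) \<in> K i" "(x', y) \<in> K j"
  shows "x < x'"
proof (rule ccontr)
  assume "\<not> x < x'"
  moreover have "x \<noteq> x'" using assms K_eqI by (metis left_def)
  ultimately have gt: "x - x' > 0" by simp
  obtain z z' w where z: "(z, w) \<in> K i" "(z', w) \<in> K j" "z' - z > 0"
    using assms(1) unfolding left_def by auto
  \<comment> \<open>The horizontal difference runs linearly from \<open>z' - z\<close> to
    \<open>x' - x\<close>; \<open>t\<close> is its zero.\<close>
  define t where "t = (z' - z) / ((z' - z) + (x - x'))"
  have t: "0 \<le> t" "t \<le> 1" using gt z(3) by (auto simp: t_def field_simps)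
  have "t * ((z' - z) + (x - x')) = z' - z" using gt z(3) by (simp add: t_def)
  then have eq: "(1 - t) * z + t * x = (1 - t) * z' + t * x'" by (simp add: algebra_simps)
  have "(1 - t) *\<^sub>R (z, w) + t *\<^sub>R (x, y) \<in> K i"
    using convexD_alt[OF convex_K[OF assms(2)] z(1) assms(4) t] .
  moreover have "(1 - t) *\<^sub>R (z', w) + t *\<^sub>R (x', y) \<in> K j"
    using convexD_alt[OF convex_K[OF assms(3)] z(2) assms(5) t] .
  ultimately have "((1 - t) * z + t * x, (1 - t) * w + t * y) \<in> K i \<inter> K j"
    using eq by simp
  then show False using disjoint_K assms by (metis empty_iff left_def)
qed

lemma presE:
  assumes "i \<in> pres y"
  obtains x where "i \<in> I" "(x, y) \<in> K i"
  using assms by (auto simp: pres_def)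

lemma presI: "i \<in> I \<Longrightarrow> (x, y) \<in> K i \<Longrightarrow> i \<in> pres y"
  by (force simp: pres_def)

lemma leftI: "(x, y) \<in> K i \<Longrightarrow> (x', y) \<in> K j \<Longrightarrow> x < x' \<Longrightarrow> i \<noteq> j \<Longrightarrow> left i j"
  by (auto simp: left_def)

lemma pres_subset: "pres y \<subseteq> I"
  by (auto simp: pres_def)

lemma finite_pres: "finite (pres y)"
  using finite_subset[OF pres_subset finite_I] .

lemma left_total:
  assumes "i \<in> pres y" "j \<in> pres y" "i \<noteq> j"
  shows "left i j \<or> left j i"
proof -
  obtain x x' where "(x, y) \<in> K i" "(x', y) \<in> K j" "i \<in> I" "j \<in> I"
    using assms by (metis presE)
  then show ?thesis
    using assms(3) leftI K_eqI by (metis linorder_neqE_linordered_idom)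
qed

lemma strict_linorder_left: "strict_linorder_on (pres y) left"
  unfolding strict_linorder_on_def
proof (intro conjI asymp_onI transp_onI totalp_onI)
  fix i j assume ij: "i \<in> pres y" "j \<in> pres y" "left i j"
  show "\<not> left j i"
  proof
    assume "left j i"
    obtain x x' where "(x, y) \<in> K i" "(x', y) \<in> K j" "i \<in> I" "j \<in> I"
      using ij by (metis presE)
    then show False using leftD[of i j x y x'] leftD[of j i x' y x] ij(3) \<open>left j i\<close> by simp
  qed
next
  fix i j k assume ij: "i \<in> pres y" "j \<in> pres y" "k \<in> pres y" "left i j" "left j k"
  obtain x x' x'' where x: "(x, y) \<in> K i" "(x', y) \<in> K j" "(x'', y) \<in> K k" "i \<in> I" "j \<in> I" "k \<in> I"
    using ij by (metis presE)
  have "x < x'" "x' < x''" using leftD ij x by blast+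
  moreover have "i \<noteq> k" using leftD[OF ij(4)] leftD[OF ij(5)] x by fastforce
  ultimately show "left i k" using x leftI by (metis less_trans)
qed (use left_total in blast)

text \<open>The heights of \<open>K i\<close> form an interval that contains \<open>y\<close> and
  misses \<open>y'\<close>, so \<open>y'\<close> is a lower bound. The infimum lies between the
  levels, strictly because neither is critical.\<close>

lemma pres_diff_low:
  assumes "i \<in> pres y" "i \<notin> pres y'" "y' < y" "y' \<notin> crit" "y \<notin> crit"
  shows "i \<in> I - low" "y' < Inf (snd ` K i)" "Inf (snd ` K i) < y" "Inf (snd ` K i) \<in> crit"
proof -
  have i: "i \<in> I" "y \<in> snd ` K i" "y' \<notin> snd ` K i" using assms by (auto simp: pres_def)
  have bd: "y' \<le> z" if "z \<in> snd ` K i" for z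
    using convex_snd_between[OF convex_K[OF i(1)] that i(2), of y'] i assms(3) by linarith
  then have bb: "bdd_below (snd ` K i)" by (meson bdd_belowI)
  then show *: "i \<in> I - low" using i by (auto simp: low_def)
  then show c: "Inf (snd ` K i) \<in> crit" by (auto simp: crit_def)
  have "y' \<le> Inf (snd ` K i)" using i bd by (intro cInf_greatest) blast+
  moreover have "Inf (snd ` K i) \<le> y" using i bb by (intro cInf_lower)
  ultimately show "y' < Inf (snd ` K i)" "Inf (snd ` K i) < y"
    using c assms by (metis order_le_less)+
qed

lemma pres_diff_high:
  assumes "i \<in> pres y" "i \<notin> pres y'" "y < y'" "y' \<notin> crit" "y \<notin> crit"
  shows "i \<in> I - high" "y < Sup (snd ` K i)" "Sup (snd ` K i) < y'" "Sup (snd ` K i) \<in> crit"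
proof -
  have i: "i \<in> I" "y \<in> snd ` K i" "y' \<notin> snd ` K i" using assms by (auto simp: pres_def)
  have bd: "z \<le> y'" if "z \<in> snd ` K i" for z
    using convex_snd_between[OF convex_K[OF i(1)] i(2) that, of y'] i assms(3) by linarith
  then have bb: "bdd_above (snd ` K i)" by (meson bdd_aboveI)
  then show *: "i \<in> I - high" using i by (auto simp: high_def)
  then show c: "Sup (snd ` K i) \<in> crit" by (auto simp: crit_def)
  have "Sup (snd ` K i) \<le> y'" using i bd by (intro cSup_least) blast+
  moreover have "y \<le> Sup (snd ` K i)" using i bb by (intro cSup_upper)
  ultimately show "y < Sup (snd ` K i)" "Sup (snd ` K i) < y'"
    using c assms by (metis order_le_less)+
qed

text \<open>Any difference would come from a set that begins or ends strictly between the levels.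
  The \<open>min\<close> and \<open>max\<close> leave the order of the two levels open.\<close>

lemma pres_eq:
  assumes "y \<notin> crit" "y' \<notin> crit" "\<And>c. c \<in> crit \<Longrightarrow> \<not> (min y y' < c \<and> c < max y y')"
  shows "pres y = pres y'"
proof -
  have *: "pres y = pres y'" if lt: "y < y'" and "y \<notin> crit" "y' \<notin> crit"
    "\<And>c. c \<in> crit \<Longrightarrow> \<not> (y < c \<and> c < y')" for y y'
    using pres_diff_low[of _ y' y] pres_diff_high[of _ y y'] that by blast
  show ?thesis
  proof (cases y y' rule: linorder_cases)
    case less
    show ?thesis by (rule *[OF less assms(1,2)]) (use assms(3) less in simp)
  next
    case greater
    show ?thesis by (rule *[OF greater assms(2,1), symmetric]) (use assms(3) greater in simp)
  qed simp
qed

lemma finite_crit: "finite crit"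
  using finite_I by (auto simp: crit_def)

lemma card_crit: "card crit \<le> card (I - low) + card (I - high)"
  unfolding crit_def using finite_I
  by (meson card_Un_le card_image_le finite_Diff add_mono le_trans)

text \<open>A set bounded below and present at \<open>y\<close>, or unbounded below and absent from
  \<open>y\<close>, would have its infimum or supremum as a critical level at most
  \<open>y\<close>.\<close>

lemma pres_below:
  assumes "\<And>c. c \<in> crit \<Longrightarrow> y < c"
  shows "pres y = low"
proof (intro equalityI subsetI)
  fix i assume "i \<in> pres y"
  then have i: "i \<in> I" "y \<in> snd ` K i" by (auto simp: pres_def)
  have False if "bdd_below (snd ` K i)"
  proof -
    have "Inf (snd ` K i) \<le> y" using that i by (intro cInf_lower)
    moreover have "Inf (snd ` K i) \<in> crit" using i that by (auto simp: crit_def low_def)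
    ultimately show False using assms by force
  qed
  then show "i \<in> low" using i by (auto simp: low_def)
next
  fix i assume "i \<in> low"
  then have i: "i \<in> I" "\<not> bdd_below (snd ` K i)" by (auto simp: low_def)
  obtain z where z: "z \<in> snd ` K i" "z < y"
    using i(2) unfolding bdd_below_def by (meson not_le)
  have "y \<in> snd ` K i"
  proof (rule ccontr)
    assume y: "y \<notin> snd ` K i"
    have bd: "w \<le> y" if "w \<in> snd ` K i" for w
      using convex_snd_between[OF convex_K[OF i(1)] z(1) that, of y] y z(2) by linarith
    then have "bdd_above (snd ` K i)" by (meson bdd_aboveI)
    then have "Sup (snd ` K i) \<in> crit" using i by (auto simp: crit_def high_def)
    moreover have "Sup (snd ` K i) \<le> y" using z bd by (intro cSup_least) blast+
    ultimately show False using assms by force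
  qed
  then show "i \<in> pres y" using i by (auto simp: pres_def)
qed

lemma pres_above:
  assumes "\<And>c. c \<in> crit \<Longrightarrow> c < y"
  shows "pres y = high"
proof (intro equalityI subsetI)
  fix i assume "i \<in> pres y"
  then have i: "i \<in> I" "y \<in> snd ` K i" by (auto simp: pres_def)
  have False if "bdd_above (snd ` K i)"
  proof -
    have "y \<le> Sup (snd ` K i)" using that i by (intro cSup_upper)
    moreover have "Sup (snd ` K i) \<in> crit" using i that by (auto simp: crit_def high_def)
    ultimately show False using assms by force
  qed
  then show "i \<in> high" using i by (auto simp: high_def)
next
  fix i assume "i \<in> high"
  then have i: "i \<in> I" "\<not> bdd_above (snd ` K i)" by (auto simp: high_def)
  obtain z where z: "z \<in> snd ` K i" "y < z"
    using i(2) unfolding bdd_above_def by (meson not_le)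
  have "y \<in> snd ` K i"
  proof (rule ccontr)
    assume y: "y \<notin> snd ` K i"
    have bd: "y \<le> w" if "w \<in> snd ` K i" for w
      using convex_snd_between[OF convex_K[OF i(1)] that z(1), of y] y z(2) by linarith
    then have "bdd_below (snd ` K i)" by (meson bdd_belowI)
    then have "Inf (snd ` K i) \<in> crit" using i by (auto simp: crit_def low_def)
    moreover have "y \<le> Inf (snd ` K i)" using z bd by (intro cInf_greatest) blast+
    ultimately show False using assms by force
  qed
  then show "i \<in> pres y" using i by (auto simp: pres_def)
qed

section \<open>Counting adjacent pairs\<close>

lemma card_adjacencies_upto:
  assumes "Y \<notin> crit" "low \<noteq> {}"
  shows "card (\<Union>y\<in>{..Y} - crit. adj left (pres y)) + 1
    \<le> card low + 2 * card {i \<in> I - low. Inf (snd ` K i) < Y} + card {i \<in> I - high. Sup (snd ` K i) < Y}"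
  using assms(1)
\<comment> \<open>The induction removes the highest critical level below \<open>Y\<close>. Without
  critical levels only the order on \<open>low\<close> contributes, at most
  \<open>card low - 1\<close> pairs; passing a level adds at most two pairs per beginning set and
  one per ending set.\<close>
proof (induction "card {c \<in> crit. c < Y}" arbitrary: Y rule: less_induct)
  case less
  define AA where "AA Y = (\<Union>y\<in>{..Y} - crit. adj left (pres y))" for Y
  define born where "born Y = {i \<in> I - low. Inf (snd ` K i) < Y}" for Y
  define died where "died Y = {i \<in> I - high. Sup (snd ` K i) < Y}" for Y
  have fin: "finite {c \<in> crit. c < Y}" "finite (born Y)" "finite (died Y)" for Y
    using finite_crit finite_I by (auto simp: born_def died_def)
  have fin_AA: "finite (AA Y)" for Y
  proof (rule finite_subset)
    show "AA Y \<subseteq> I \<times> I"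
      using adj_subset pres_subset by (fastforce simp: AA_def)
  qed (use finite_I in simp)
  have "card (AA Y) + 1 \<le> card low + 2 * card (born Y) + card (died Y)"
  proof (cases "{c \<in> crit. c < Y} = {}")
    case True
    then have nocrit: "Y < c" if "c \<in> crit" for c
      using that less.prems by (metis (mono_tags, lifting) empty_iff linorder_neqE_linordered_idom mem_Collect_eq)
    have "pres y = low" if "y \<le> Y" for y
      using nocrit that by (intro pres_below) force
    then have "AA Y = adj left low" using less.prems by (auto simp: AA_def)
    moreover have "pres Y = low" using nocrit by (rule pres_below)
    ultimately show ?thesis
      using card_adj[OF strict_linorder_left finite_pres, of Y] assms(2) by simp
  next
    case False
    define c where "c = Max {c \<in> crit. c < Y}"
    have c: "c \<in> crit" "c < Y"
      using Max_in[OF fin(1) False] by (auto simp: c_def)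
    have c_max: "c' \<le> c" if "c' \<in> crit" "c' < Y" for c'
      using that fin by (auto simp: c_def)
    obtain d where d: "d > 0" "\<And>c'. c' \<in> crit \<Longrightarrow> c' \<noteq> c \<Longrightarrow> d < \<bar>c' - c\<bar>"
      using finite_gap[OF finite_crit] by metis
    \<comment> \<open>A level just below \<open>c\<close>, with no critical level in
      between.\<close>
    define Y' where "Y' = c - d"
    have Y': "Y' \<notin> crit" "Y' < c" "\<And>c'. c' \<in> crit \<Longrightarrow> c' < c \<Longrightarrow> c' < Y'"
      using d by (force simp: Y'_def)+
    have lt: "Y' < Y" using Y' c by simp
    have "c \<in> {c \<in> crit. c < Y} - {c \<in> crit. c < Y'}" using c Y'(2) by simp
    moreover have "{c \<in> crit. c < Y'} \<subseteq> {c \<in> crit. c < Y}" using lt by auto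
    ultimately have "{c \<in> crit. c < Y'} \<subset> {c \<in> crit. c < Y}" by blast
    then have "card {c \<in> crit. c < Y'} < card {c \<in> crit. c < Y}"
      using fin(1) by (rule psubset_card_mono[rotated])
    then have IH: "card (AA Y') + 1 \<le> card low + 2 * card (born Y') + card (died Y')"
      using less.hyps Y'(1) unfolding AA_def born_def died_def by blast
    \<comment> \<open>A non-critical level up to \<open>Y\<close> sees the same sets as
      \<open>Y\<close> if it is above \<open>c\<close>, the same as \<open>Y'\<close> if it is
      between \<open>Y'\<close> and \<open>c\<close>, and is otherwise counted in
      \<open>AA Y'\<close>.\<close>
    have "pres y = pres Y" if "c < y" "y \<le> Y" "y \<notin> crit" for y
      using that less.prems c_max by (intro pres_eq) force+
    moreover have "pres y = pres Y'" if "Y' < y" "y < c" "y \<notin> crit" for y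
      using that Y' by (intro pres_eq) force+
    ultimately have "pres y = pres Y \<or> pres y = pres Y' \<or> y \<le> Y'" if "y \<le> Y" "y \<notin> crit" for y
      using that c(1) by (metis linorder_less_linear not_le)
    then have "AA Y \<subseteq> AA Y' \<union> (adj left (pres Y) - adj left (pres Y'))"
      using Y'(1) by (fastforce simp: AA_def)
    then have "card (AA Y) \<le> card (AA Y' \<union> (adj left (pres Y) - adj left (pres Y')))"
      using fin_AA finite_subset[OF adj_subset, of "pres Y"] finite_pres
      by (intro card_mono) auto
    also have "\<dots> \<le> card (AA Y') + card (adj left (pres Y) - adj left (pres Y'))"
      by (rule card_Un_le)
    also have "\<dots> \<le> card (AA Y') + (2 * card (pres Y - pres Y') + card (pres Y' - pres Y))"
      using card_adj_diff strict_linorder_left finite_pres by (metis add_left_mono)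
    finally have A: "card (AA Y) \<le> card (AA Y') + 2 * card (pres Y - pres Y') + card (pres Y' - pres Y)"
      by simp
    have "pres Y - pres Y' \<subseteq> born Y - born Y'"
      using pres_diff_low[OF _ _ lt Y'(1) less.prems] by (fastforce simp: born_def)
    then have "card (pres Y - pres Y') \<le> card (born Y - born Y')"
      using fin by (intro card_mono) auto
    also have "\<dots> = card (born Y) - card (born Y')"
      using lt fin by (intro card_Diff_subset) (auto simp: born_def)
    finally have B: "card (pres Y - pres Y') \<le> card (born Y) - card (born Y')" .
    have "pres Y' - pres Y \<subseteq> died Y - died Y'"
      using pres_diff_high[OF _ _ lt less.prems Y'(1)] by (fastforce simp: died_def)
    then have "card (pres Y' - pres Y) \<le> card (died Y - died Y')"
      using fin by (intro card_mono) auto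
    also have "\<dots> = card (died Y) - card (died Y')"
      using lt fin by (intro card_Diff_subset) (auto simp: died_def)
    finally have D: "card (pres Y' - pres Y) \<le> card (died Y) - card (died Y')" .
    have "card (born Y') \<le> card (born Y)" "card (died Y') \<le> card (died Y)"
      using lt fin by (auto intro!: card_mono simp: born_def died_def)
    then show ?thesis using A B D IH by linarith
  qed
  then show ?case unfolding AA_def born_def died_def .
qed

text \<open>All levels above the last critical one see the same sets, so a single \<open>Y\<close>
  beyond it accounts for every pair.\<close>

lemma card_adjacencies:
  assumes "low \<noteq> {}"
  shows "card (\<Union>y\<in>-crit. adj left (pres y)) + 1 \<le> card low + 2 * card (I - low) + card (I - high)"
proof -
  obtain Y where Y: "\<And>c. c \<in> crit \<Longrightarrow> c < Y"
    using finite_crit by (metis bdd_above_finite bdd_above_def gt_ex le_less_trans)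
  have "pres y = pres (min y Y)" if "y \<notin> crit" for y
    using that Y by (intro pres_eq) (force simp: min_def split: if_splits)+
  moreover have "min y Y \<in> {..Y} - crit" if "y \<notin> crit" for y
    using that Y by (force simp: min_def)
  ultimately have "(\<Union>y\<in>-crit. adj left (pres y)) \<subseteq> (\<Union>y\<in>{..Y} - crit. adj left (pres y))"
    by (smt (verit) ComplD SUP_least UN_upper)
  then have eq: "(\<Union>y\<in>-crit. adj left (pres y)) = (\<Union>y\<in>{..Y} - crit. adj left (pres y))"
    by auto
  have "card (\<Union>y\<in>{..Y} - crit. adj left (pres y)) + 1
    \<le> card low + 2 * card {i \<in> I - low. Inf (snd ` K i) < Y} + card {i \<in> I - high. Sup (snd ` K i) < Y}"
    using Y assms by (intro card_adjacencies_upto) auto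
  also have "\<dots> \<le> card low + 2 * card (I - low) + card (I - high)"
    using finite_I by (intro add_mono mult_le_mono2 card_mono order_refl) auto
  finally show ?thesis by (simp only: eq)
qed

section \<open>Neighbours of an uncovered point\<close>

lemma frequently_in_some:
  assumes "F \<noteq> bot" "\<forall>\<^sub>F x in F. (x, y) \<notin> S"
  shows "\<exists>i\<in>I. \<exists>\<^sub>F x in F. (x, y) \<in> K i"
proof (rule ccontr)
  assume "\<not> (\<exists>i\<in>I. \<exists>\<^sub>F x in F. (x, y) \<in> K i)"
  then have "\<forall>i\<in>I. \<forall>\<^sub>F x in F. (x, y) \<notin> K i" by (auto simp: frequently_def)
  \<comment> \<open>Pigeonhole along the filter: as \<open>I\<close> is finite, the eventual
    statements for the single sets combine.\<close>
  then have "\<forall>\<^sub>F x in F. \<forall>i\<in>I. (x, y) \<notin> K i" by (rule eventually_ball_finite[OF finite_I])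
  with assms(2) have "\<forall>\<^sub>F x in F. False"
    by eventually_elim (use in_some in blast)
  then show False using assms(1) by (simp add: eventually_False)
qed

text \<open>Neighbours on the level, expressed by accumulation: this closeness rules out sets in
  between and places the point on separating lines.\<close>

definition touch :: "'i \<Rightarrow> 'i \<Rightarrow> real \<Rightarrow> real \<Rightarrow> bool" where
  "touch a b x y \<longleftrightarrow> (\<forall>e>0. \<exists>x'. x - e < x' \<and> x' < x \<and> (x', y) \<in> K a)
     \<and> (\<forall>e>0. \<exists>x'. x < x' \<and> x' < x + e \<and> (x', y) \<in> K b)"

text \<open>By genericity the rest of the level is free of \<open>S\<close>, hence covered by
  finitely many sets on either side of \<open>x\<close>.\<close>

lemma touch_exists:
  assumes "(x, y) \<in> S"
  shows "\<exists>a\<in>I. \<exists>b\<in>I. touch a b x y"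
proof -
  have S: "x' = x" if "(x', y) \<in> S" for x'
    using inj_onD[OF inj_snd_S _ that assms] by simp
  have "\<exists>a\<in>I. \<exists>\<^sub>F x in at_left x. (x, y) \<in> K a"
    by (rule frequently_in_some) (auto simp: eventually_at_left_field intro!: exI[of _ "x - 1"] dest: S)
  then obtain a where a: "a \<in> I" "\<exists>\<^sub>F x in at_left x. (x, y) \<in> K a" by blast
  have "\<exists>a\<in>I. \<exists>\<^sub>F x in at_right x. (x, y) \<in> K a"
    by (rule frequently_in_some) (auto simp: eventually_at_right_field intro!: exI[of _ "x + 1"] dest: S)
  then obtain b where b: "b \<in> I" "\<exists>\<^sub>F x in at_right x. (x, y) \<in> K b" by blast
  have "\<exists>x'. x - e < x' \<and> x' < x \<and> (x', y) \<in> K a" if "e > 0" for e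
  proof (rule ccontr)
    assume "\<not> ?thesis"
    then have "\<forall>\<^sub>F x in at_left x. (x, y) \<notin> K a"
      using that by (auto simp: eventually_at_left_field intro!: exI[of _ "x - e"])
    then show False using a by (simp add: frequently_def)
  qed
  moreover have "\<exists>x'. x < x' \<and> x' < x + e \<and> (x', y) \<in> K b" if "e > 0" for e
  proof (rule ccontr)
    assume "\<not> ?thesis"
    then have "\<forall>\<^sub>F x in at_right x. (x, y) \<notin> K b"
      using that by (auto simp: eventually_at_right_field intro!: exI[of _ "x + e"])
    then show False using b by (simp add: frequently_def)
  qed
  ultimately show ?thesis using a b unfolding touch_def by blast
qed

text \<open>If \<open>a = b\<close>, convexity would put \<open>(x, y)\<close> into
  \<open>K a\<close>. A set in between would have a point on the level to one side of
  \<open>x\<close>, where \<open>K a\<close> or \<open>K b\<close> comes closer.\<close>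

lemma touch_adj:
  assumes "(x, y) \<in> S" "a \<in> I" "b \<in> I" "touch a b x y"
  shows "(a, b) \<in> adj left (pres y)"
proof -
  obtain x1 where x1: "x1 < x" "(x1, y) \<in> K a"
    using assms(4) unfolding touch_def by (meson zero_less_one)
  obtain x2 where x2: "x < x2" "(x2, y) \<in> K b"
    using assms(4) unfolding touch_def by (meson zero_less_one)
  have "a \<noteq> b"
    using convex_horizontal[OF convex_K[OF assms(2)] x1(2), of x2 x] x1 x2 not_in_S assms by force
  then have "left a b" using leftI[OF x1(2) x2(2)] x1 x2 by simp
  moreover have False if k: "k \<in> pres y" "left a k" "left k b" for k
  proof -
    obtain z where z: "k \<in> I" "(z, y) \<in> K k" using k(1) by (rule presE)
    then have "z \<noteq> x" using assms(1) not_in_S by blast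
    then consider "z < x" | "x < z" by linarith
    then show False
    proof cases
      case 1
      then obtain x' where "x - (x - z) < x'" "(x', y) \<in> K a"
        using assms(4) unfolding touch_def by (meson diff_gt_0_iff_gt)
      then show False using leftD[OF k(2) assms(2) z(1) _ z(2)] by force
    next
      case 2
      then obtain x' where "x' < x + (z - x)" "(x', y) \<in> K b"
        using assms(4) unfolding touch_def by (meson diff_gt_0_iff_gt)
      then show False using leftD[OF k(3) z(1) assms(3) z(2)] by force
    qed
  qed
  ultimately show ?thesis using x1 x2 assms presI by (auto simp: adj_def)
qed

text \<open>A point approached from both sides lies on any line separating \<open>K a\<close> from
  \<open>K b\<close>. Two such points at different heights show that this line is not horizontal, so
  it is a graph over the height.\<close>

lemma touch_separating_line:
  assumes ab: "a \<in> I" "b \<in> I" "a \<noteq> b"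
    and p: "touch a b x1 y1" and q: "touch a b x2 y2" and "y1 \<noteq> y2"
  obtains c m where "x1 = c + m * y1" "x2 = c + m * y2"
    "\<And>x y. (x, y) \<in> K a \<Longrightarrow> x \<le> c + m * y" "\<And>x y. (x, y) \<in> K b \<Longrightarrow> c + m * y \<le> x"
proof -
  have pa: "\<exists>x'. x1 - e < x' \<and> x' < x1 \<and> (x', y1) \<in> K a"
    and pb: "\<exists>x'. x1 < x' \<and> x' < x1 + e \<and> (x', y1) \<in> K b"
    and qa: "\<exists>x'. x2 - e < x' \<and> x' < x2 \<and> (x', y2) \<in> K a"
    and qb: "\<exists>x'. x2 < x' \<and> x' < x2 + e \<and> (x', y2) \<in> K b" if "e > 0" for e
    using p q that by (auto simp: touch_def)
  have "K a \<noteq> {}" "K b \<noteq> {}" using pa[of 1] pb[of 1] by auto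
  then obtain h r where h: "h \<noteq> 0" "\<forall>x\<in>K a. inner h x \<le> r" "\<forall>x\<in>K b. r \<le> inner h x"
    using separating_hyperplane_sets[of "K a" "K b"] convex_K ab disjoint_K by metis
  obtain u v where uv: "h = (u, v)" by (cases h)
  have ha: "u * x + v * y \<le> r" if "(x, y) \<in> K a" for x y
    using h(2) that by (force simp: uv)
  have hb: "r \<le> u * x + v * y" if "(x, y) \<in> K b" for x y
    using h(3) that by (force simp: uv)
  have on_line: "u * x + v * y = r" if t: "touch a b x y" for x y
  proof (rule antisym)
    show "u * x + v * y \<le> r"
    proof (rule field_le_epsilon)
      fix e :: real assume "e > 0"
      \<comment> \<open>The divisor is \<open>\<bar>u\<bar> + 1\<close> because \<open>u\<close> is
        not yet known to be nonzero.\<close>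
      then have "e / (\<bar>u\<bar> + 1) > 0" by (simp add: add_pos_nonneg)
      then obtain x' where x': "x - e / (\<bar>u\<bar> + 1) < x'" "x' < x" "(x', y) \<in> K a"
        using t unfolding touch_def by meson
      have "u * (x - x') \<le> (\<bar>u\<bar> + 1) * (e / (\<bar>u\<bar> + 1))"
        using x' by (intro mult_mono) auto
      also have "\<dots> = e" by (simp add: field_simps add_nonneg_eq_0_iff)
      finally show "u * x + v * y \<le> r + e"
        using ha[OF x'(3)] by (simp add: algebra_simps)
    qed
    show "r \<le> u * x + v * y"
    proof (rule field_le_epsilon)
      fix e :: real assume "e > 0"
      then have "e / (\<bar>u\<bar> + 1) > 0" by (simp add: add_pos_nonneg)
      then obtain x' where x': "x < x'" "x' < x + e / (\<bar>u\<bar> + 1)" "(x', y) \<in> K b"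
        using t unfolding touch_def by meson
      have "u * (x' - x) \<le> (\<bar>u\<bar> + 1) * (e / (\<bar>u\<bar> + 1))"
        using x' by (intro mult_mono) auto
      also have "\<dots> = e" by (simp add: field_simps add_nonneg_eq_0_iff)
      finally show "r \<le> u * x + v * y + e"
        using hb[OF x'(3)] by (simp add: algebra_simps)
    qed
  qed
  have eq1: "u * x1 + v * y1 = r" and eq2: "u * x2 + v * y2 = r" using on_line p q by auto
  have "u \<noteq> 0"
  proof
    assume "u = 0"
    then have "v * (y1 - y2) = 0" using eq1 eq2 by (simp add: algebra_simps)
    then show False using \<open>u = 0\<close> h(1) uv \<open>y1 \<noteq> y2\<close> by (simp add: zero_prod_def)
  qed
  \<comment> \<open>A point of \<open>K a\<close> left of \<open>x1\<close> on the same level fixes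
    the sign of \<open>u\<close>.\<close>
  moreover obtain x' where "x' < x1" "(x', y1) \<in> K a" using pa[of 1] by auto
  then have "u * x' \<le> u * x1" using ha eq1 by fastforce
  ultimately have "u > 0" using \<open>x' < x1\<close> by (auto simp: mult_le_cancel_left)
  show ?thesis
  proof (rule that[of "r / u" "- v / u"])
    show "x1 = r / u + - v / u * y1" "x2 = r / u + - v / u * y2"
      using \<open>u > 0\<close> eq1 eq2 by (simp_all add: field_simps)
    show "x \<le> r / u + - v / u * y" if "(x, y) \<in> K a" for x y
      using \<open>u > 0\<close> ha[OF that] by (simp add: field_simps)
    show "r / u + - v / u * y \<le> x" if "(x, y) \<in> K b" for x y
      using \<open>u > 0\<close> hb[OF that] by (simp add: field_simps)
  qed
qed

text \<open>All of \<open>K a\<close> and \<open>K b\<close> lie on opposite sides of the line through the two points, and on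
  this line the sets \<open>K a\<close> and \<open>K b\<close> own a point before, between and after the two. Two of
  these three points belong to the same convex set, which hence contains a point of \<open>S\<close>.\<close>

lemma touch_unique:
  assumes S: "(x1, y1) \<in> S" "(x2, y2) \<in> S" and "y1 < y2" and crit: "y1 \<notin> crit" "y2 \<notin> crit"
    and ab: "a \<in> I" "b \<in> I" and touch: "touch a b x1 y1" "touch a b x2 y2"
  shows False
proof -
  have adj: "(a, b) \<in> adj left (pres y1)" "(a, b) \<in> adj left (pres y2)"
    using touch_adj S ab touch by blast+
  then have "a \<noteq> b" by (auto simp: adj_def left_def)
  then obtain c m where x: "x1 = c + m * y1" "x2 = c + m * y2"
    and le: "\<And>x y. (x, y) \<in> K a \<Longrightarrow> x \<le> c + m * y" "\<And>x y. (x, y) \<in> K b \<Longrightarrow> c + m * y \<le> x"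
    using touch_separating_line[OF ab _ touch] \<open>y1 < y2\<close> by (metis less_irrefl)
  \<comment> \<open>A set owning this point of the line can be neither left of \<open>K a\<close>
    nor right of \<open>K b\<close>, and adjacency leaves no room between the two.\<close>
  have on_line: "(c + m * y, y) \<in> K a \<or> (c + m * y, y) \<in> K b"
    if adj: "(a, b) \<in> adj left (pres y)" and y: "y \<notin> snd ` S" for y
  proof -
    have "(c + m * y, y) \<notin> S" using y by force
    then obtain k where k: "k \<in> I" "(c + m * y, y) \<in> K k" using in_some by blast
    then have k_pres: "k \<in> pres y" by (rule presI)
    have ab_pres: "a \<in> pres y" "b \<in> pres y" using adj by (auto simp: adj_def)
    then obtain xa xb where xab: "(xa, y) \<in> K a" "(xb, y) \<in> K b" by (metis presE)
    have "\<not> left k a" using leftD[OF _ k(1) ab(1) k(2) xab(1)] le(1)[OF xab(1)] by fastforce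
    moreover have "\<not> left b k" using leftD[OF _ ab(2) k(1) xab(2) k(2)] le(2)[OF xab(2)] by fastforce
    ultimately have "k = a \<or> k = b"
      using left_total[OF k_pres ab_pres(1)] left_total[OF k_pres ab_pres(2)] adj k_pres
      by (auto simp: adj_def)
    then show ?thesis using k by blast
  qed
  have fin: "finite (crit \<union> snd ` S)" using finite_crit finite_S by simp
  obtain d where d: "d > 0" "\<And>c. c \<in> crit \<union> snd ` S \<Longrightarrow> c \<noteq> y1 \<Longrightarrow> d < \<bar>c - y1\<bar>"
    using finite_gap[OF fin] by metis
  obtain e where e: "e > 0" "\<And>c. c \<in> crit \<union> snd ` S \<Longrightarrow> c \<noteq> y2 \<Longrightarrow> e < \<bar>c - y2\<bar>"
    using finite_gap[OF fin] by metis
  \<comment> \<open>Sample levels just below and above \<open>y1\<close> and just above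
    \<open>y2\<close>. They are free of \<open>S\<close> and see the same sets as \<open>y1\<close>
    or \<open>y2\<close>, so \<open>a\<close> and \<open>b\<close> are still adjacent there.\<close>
  define u v w where "u = y1 - d" and "v = y1 + d" and "w = y2 + e"
  have "y2 \<in> crit \<union> snd ` S" using S by force
  then have lt: "u < y1" "y1 < v" "v < y2" "y2 < w"
    using d(1) d(2)[of y2] e(1) \<open>y1 < y2\<close> by (auto simp: u_def v_def w_def)
  have notin: "u \<notin> crit \<union> snd ` S" "v \<notin> crit \<union> snd ` S" "w \<notin> crit \<union> snd ` S"
    using d(1) d(2)[of u] d(2)[of v] e(1) e(2)[of w] by (auto simp: u_def v_def w_def)
  have "pres u = pres y1"
  proof (rule pres_eq)
    show "\<not> (min u y1 < c \<and> c < max u y1)" if "c \<in> crit" for c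
      using d(1) d(2)[of c] that by (auto simp: u_def)
  qed (use notin crit in auto)
  moreover have "pres v = pres y1"
  proof (rule pres_eq)
    show "\<not> (min v y1 < c \<and> c < max v y1)" if "c \<in> crit" for c
      using d(1) d(2)[of c] that by (auto simp: v_def)
  qed (use notin crit in auto)
  moreover have "pres w = pres y2"
  proof (rule pres_eq)
    show "\<not> (min w y2 < c \<and> c < max w y2)" if "c \<in> crit" for c
      using e(1) e(2)[of c] that by (auto simp: w_def)
  qed (use notin crit in auto)
  ultimately have in_ab: "\<exists>k\<in>{a, b}. (c + m * y, y) \<in> K k" if "y \<in> {u, v, w}" for y
    using on_line[of y] that adj notin by auto
  have excl: False if "k \<in> {a, b}" "(c + m * y, y) \<in> K k" "(c + m * y', y') \<in> K k"
    "y \<le> z" "z \<le> y'" "(c + m * z, z) \<in> S" for k y y' z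
    using convex_oblique[OF convex_K that(2-5)] not_in_S that(1,6) ab by blast
  obtain k1 k2 k3 where k: "k1 \<in> {a, b}" "(c + m * u, u) \<in> K k1" "k2 \<in> {a, b}" "(c + m * v, v) \<in> K k2"
    "k3 \<in> {a, b}" "(c + m * w, w) \<in> K k3"
    using in_ab by (metis insertCI)
  have "k1 \<noteq> k2" using excl[OF k(1,2), of v y1] k(4) lt S x by auto
  moreover have "k2 \<noteq> k3" using excl[OF k(3,4), of w y2] k(6) lt S x by auto
  moreover have "k1 \<noteq> k3" using excl[OF k(1,2), of w y1] k(6) lt S x by auto
  ultimately show False using k by auto
qed

text \<open>Critical levels carry at most one point of \<open>S\<close> each, and the other points
  inject into the adjacent pairs by \<open>touch_unique\<close>; the two counts are added.\<close>

lemma card_S_le: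
  assumes "low \<noteq> {}"
  shows "card S + 1 \<le> card low + 3 * card (I - low) + 2 * card (I - high)"
proof -
  define S1 where "S1 = {p \<in> S. snd p \<in> crit}"
  define S2 where "S2 = {p \<in> S. snd p \<notin> crit}"
  define A where "A = (\<Union>y\<in>-crit. adj left (pres y))"
  have "inj_on snd S1" using inj_snd_S by (rule inj_on_subset) (auto simp: S1_def)
  then have "card S1 \<le> card crit"
    using finite_crit by (intro card_inj_on_le[of snd]) (auto simp: S1_def)
  have "\<forall>p\<in>S. \<exists>a b. a \<in> I \<and> b \<in> I \<and> touch a b (fst p) (snd p)"
    using touch_exists by (metis prod.collapse)
  then obtain f g where fg: "\<And>p. p \<in> S \<Longrightarrow> f p \<in> I \<and> g p \<in> I \<and> touch (f p) (g p) (fst p) (snd p)"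
    by metis
  have "inj_on (\<lambda>p. (f p, g p)) S2"
  proof (rule inj_onI)
    fix p q assume p: "p \<in> S2" and q: "q \<in> S2" and eq: "(f p, g p) = (f q, g q)"
    have pS: "p \<in> S" "snd p \<notin> crit" and qS: "q \<in> S" "snd q \<notin> crit" using p q by (auto simp: S2_def)
    have "\<not> snd p < snd q"
      using touch_unique[of "fst p" "snd p" "fst q" "snd q" "f p" "g p"] pS qS fg[of p] fg[of q] eq by auto
    moreover have "\<not> snd q < snd p"
      using touch_unique[of "fst q" "snd q" "fst p" "snd p" "f p" "g p"] pS qS fg[of p] fg[of q] eq by auto
    ultimately show "p = q" using inj_onD[OF inj_snd_S _ pS(1) qS(1)] by simp
  qed
  moreover have "(\<lambda>p. (f p, g p)) ` S2 \<subseteq> A"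
  proof clarify
    fix p assume "p \<in> S2"
    then have "p \<in> S" "snd p \<notin> crit" by (auto simp: S2_def)
    then have "(f p, g p) \<in> adj left (pres (snd p))"
      using touch_adj[of "fst p" "snd p" "f p" "g p"] fg[of p] by simp
    then show "(f p, g p) \<in> A" using \<open>snd p \<notin> crit\<close> by (auto simp: A_def)
  qed
  moreover have "finite A"
  proof (rule finite_subset)
    show "A \<subseteq> I \<times> I" using adj_subset pres_subset by (fastforce simp: A_def)
  qed (use finite_I in simp)
  ultimately have "card S2 \<le> card A" by (rule card_inj_on_le)
  have "S = S1 \<union> S2" by (auto simp: S1_def S2_def)
  then have "card S \<le> card S1 + card S2" using card_Un_le by metis
  then show ?thesis
    using card_adjacencies[OF assms] card_crit \<open>card S1 \<le> card crit\<close> \<open>card S2 \<le> card A\<close>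
    unfolding A_def by linarith
qed

section \<open>Horizontal rays and the case distinction\<close>

definition left_ray :: "'i \<Rightarrow> real \<Rightarrow> bool" where
  "left_ray i y \<longleftrightarrow> (\<exists>x. \<forall>z\<le>x. (z, y) \<in> K i)"

definition right_ray :: "'i \<Rightarrow> real \<Rightarrow> bool" where
  "right_ray i y \<longleftrightarrow> (\<exists>x. \<forall>z\<ge>x. (z, y) \<in> K i)"

text \<open>One of the finitely many sets has points arbitrarily far to the left on this level, and
  convexity fills in a ray.\<close>

lemma left_ray_exists:
  assumes "y \<notin> snd ` S"
  shows "\<exists>i\<in>I. left_ray i y"
proof -
  have "(x, y) \<notin> S" for x using assms by force
  then obtain i where i: "i \<in> I" "\<exists>\<^sub>F x in at_bot. (x, y) \<in> K i"
    using frequently_in_some[of at_bot y] by auto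
  have ex: "\<exists>x\<le>N. (x, y) \<in> K i" for N
  proof (rule ccontr)
    assume "\<not> ?thesis"
    then have "\<forall>\<^sub>F x in at_bot. (x, y) \<notin> K i" by (auto simp: eventually_at_bot_linorder)
    then show False using i by (simp add: frequently_def)
  qed
  obtain x0 where x0: "(x0, y) \<in> K i" using ex by blast
  have "(z, y) \<in> K i" if "z \<le> x0" for z
    using ex[of z] convex_horizontal[OF convex_K[OF i(1)] _ x0 _ that] by blast
  then show ?thesis using i unfolding left_ray_def by blast
qed

lemma right_ray_exists:
  assumes "y \<notin> snd ` S"
  shows "\<exists>i\<in>I. right_ray i y"
proof -
  have "(x, y) \<notin> S" for x using assms by force
  then obtain i where i: "i \<in> I" "\<exists>\<^sub>F x in at_top. (x, y) \<in> K i"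
    using frequently_in_some[of at_top y] by auto
  have ex: "\<exists>x\<ge>N. (x, y) \<in> K i" for N
  proof (rule ccontr)
    assume "\<not> ?thesis"
    then have "\<forall>\<^sub>F x in at_top. (x, y) \<notin> K i" by (auto simp: eventually_at_top_linorder)
    then show False using i by (simp add: frequently_def)
  qed
  obtain x0 where x0: "(x0, y) \<in> K i" using ex by blast
  have "(z, y) \<in> K i" if "x0 \<le> z" for z
    using ex[of z] convex_horizontal[OF convex_K[OF i(1)] x0 _ that] by blast
  then show ?thesis using i unfolding right_ray_def by blast
qed

text \<open>Each point is moved up along the line by less than any gap and assigned to the set
  covering it there. A set assigned to two points would contain the upper one.\<close>

lemma card_collinear_le:
  assumes line: "\<And>x y. (x, y) \<in> S \<Longrightarrow> x = c + m * y"
  shows "card S \<le> card I"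
proof -
  define D where "D = (\<lambda>(p, q). snd p - snd q) ` (S \<times> S)"
  have "finite D" using finite_S by (simp add: D_def)
  then obtain d where d: "d > 0" "\<And>r. r \<in> D \<Longrightarrow> r \<noteq> 0 \<Longrightarrow> d < \<bar>r - 0\<bar>"
    using finite_gap[of D 0] by metis
  have gap: "d < \<bar>snd p - snd q\<bar>" if "p \<in> S" "q \<in> S" "p \<noteq> q" for p q
  proof -
    have "snd p \<noteq> snd q" using inj_onD[OF inj_snd_S] that by blast
    then show ?thesis using d(2)[of "snd p - snd q"] that by (force simp: D_def)
  qed
  define P where "P y = (c + m * y, y)" for y
  have snd_P: "snd (P y) = y" for y by (simp add: P_def)
  have "P (snd p + d) \<notin> S" if "p \<in> S" for p
  proof
    assume "P (snd p + d) \<in> S"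
    moreover have "p \<noteq> P (snd p + d)" using snd_P[of "snd p + d"] d(1) by force
    ultimately show False using gap[OF that, of "P (snd p + d)"] d(1) by (simp add: snd_P)
  qed
  then have "\<forall>p\<in>S. \<exists>i\<in>I. P (snd p + d) \<in> K i" using in_some by blast
  then obtain f where f: "\<And>p. p \<in> S \<Longrightarrow> f p \<in> I \<and> P (snd p + d) \<in> K (f p)" by metis
  have neq: "f p \<noteq> f q" if "p \<in> S" "q \<in> S" "snd p < snd q" for p q
  proof
    assume eq: "f p = f q"
    have "p \<noteq> q" using that by auto
    then have "snd p + d \<le> snd q" using gap[OF that(1,2)] that(3) by linarith
    then have "P (snd q) \<in> K (f q)"
      using convex_oblique[of "K (f q)" c m "snd p + d" "snd q + d" "snd q"] f[OF that(1)] f[OF that(2)]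
        convex_K eq d(1) by (auto simp: P_def)
    moreover have "P (snd q) = q" using line[of "fst q" "snd q"] that(2) by (simp add: P_def prod_eq_iff)
    ultimately show False using not_in_S f that by metis
  qed
  have "inj_on f S"
    using neq inj_onD[OF inj_snd_S] by (intro inj_onI) (metis linorder_neqE_linordered_idom)
  then show ?thesis using f finite_I by (intro card_inj_on_le[of f]) auto
qed

text \<open>The split point is the supremum of the part of \<open>K a\<close> on the level: to its
  left the ray and convexity fill \<open>K a\<close>, to its right only \<open>K b\<close> can
  cover.\<close>

lemma two_sets_on_level:
  assumes "pres y \<subseteq> {a, b}" "y \<notin> snd ` S" "a \<in> I" "b \<in> I" "a \<noteq> b" "left_ray a y" "right_ray b y"
  obtains s where "\<And>z. z < s \<Longrightarrow> (z, y) \<in> K a" "\<And>z. s < z \<Longrightarrow> (z, y) \<in> K b"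
proof -
  obtain l where l: "\<And>z. z \<le> l \<Longrightarrow> (z, y) \<in> K a" using assms(6) by (auto simp: left_ray_def)
  obtain r where r: "\<And>z. z \<ge> r \<Longrightarrow> (z, y) \<in> K b" using assms(7) by (auto simp: right_ray_def)
  define X where "X = {x. (x, y) \<in> K a}"
  have "x \<le> r" if "x \<in> X" for x
    using that r[of x] K_eqI[of "(x, y)" a b] assms(3-5) by (force simp: X_def)
  then have bdd: "bdd_above X" by (meson bdd_aboveI)
  have "X \<noteq> {}" using l by (auto simp: X_def)
  show ?thesis
  proof (rule that[of "Sup X"])
    fix z assume "z < Sup X"
    then obtain x where x: "x \<in> X" "z < x" using less_cSup_iff[OF \<open>X \<noteq> {}\<close> bdd] by blast
    show "(z, y) \<in> K a"
      using convex_horizontal[OF convex_K[OF assms(3)] l[of "min l z"], of x z] x by (auto simp: X_def)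
  next
    fix z assume "Sup X < z"
    then have "z \<notin> X" using cSup_upper[OF _ bdd] by force
    moreover have "(z, y) \<notin> S" using assms(2) by force
    then obtain k where "k \<in> I" "(z, y) \<in> K k" using in_some by blast
    moreover from this have "k \<in> {a, b}" using presI assms(1) by blast
    ultimately show "(z, y) \<in> K b" by (auto simp: X_def)
  qed
qed

text \<open>On levels below and above all critical levels and all of \<open>S\<close>, genericity
  gives the same leftmost set \<open>a\<close> and the same rightmost set \<open>b\<close>. Both are
  therefore unbounded below and above.\<close>

lemma card_S_le_generic:
  assumes "3 \<le> card I"
    and gen_left: "\<And>i j y y'. i \<in> I \<Longrightarrow> j \<in> I \<Longrightarrow> left_ray i y \<Longrightarrow> left_ray j y' \<Longrightarrow> i = j"
    and gen_right: "\<And>i j y y'. i \<in> I \<Longrightarrow> j \<in> I \<Longrightarrow> right_ray i y \<Longrightarrow> right_ray j y' \<Longrightarrow> i = j"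
  shows "card S \<le> 5 * card I - 11"
proof -
  have fin: "finite (crit \<union> snd ` S)" using finite_crit finite_S by simp
  obtain y0 where y0: "\<And>c. c \<in> crit \<union> snd ` S \<Longrightarrow> y0 < c"
    using bdd_below_finite[OF fin] by (metis bdd_below_def lt_ex less_le_trans)
  obtain y1 where y1: "\<And>c. c \<in> crit \<union> snd ` S \<Longrightarrow> c < y1"
    using bdd_above_finite[OF fin] by (metis bdd_above_def gt_ex le_less_trans)
  have notin: "y0 \<notin> snd ` S" "y1 \<notin> snd ` S" using y0 y1 by blast+
  have pres: "pres y0 = low" "pres y1 = high" using y0 y1 by (auto intro!: pres_below pres_above)
  obtain a where a: "a \<in> I" "left_ray a y0" "left_ray a y1"
    using left_ray_exists[OF notin(1)] left_ray_exists[OF notin(2)] gen_left by metis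
  obtain b where b: "b \<in> I" "right_ray b y0" "right_ray b y1"
    using right_ray_exists[OF notin(1)] right_ray_exists[OF notin(2)] gen_right by metis
  have ab: "{a, b} \<subseteq> low" "{a, b} \<subseteq> high"
    using a b unfolding pres[symmetric] left_ray_def right_ray_def by (blast intro: presI)+
  have fin_lh: "finite low" "finite high" using finite_I by (auto simp: low_def high_def)
  show ?thesis
  proof (cases "a = b")
    case True
    \<comment> \<open>\<open>K a\<close> contains both extreme levels entirely, hence the strip
      between them, where all of \<open>S\<close> lies.\<close>
    have line: "(x, y) \<in> K a" if "left_ray a y" "right_ray a y" for x y
    proof -
      obtain l r where "\<And>z. z \<le> l \<Longrightarrow> (z, y) \<in> K a" "\<And>z. z \<ge> r \<Longrightarrow> (z, y) \<in> K a"
        using \<open>left_ray a y\<close> \<open>right_ray a y\<close> by (auto simp: left_ray_def right_ray_def)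
      then show ?thesis
        using convex_horizontal[OF convex_K[OF a(1)], of "min l x" y "max r x" x] by simp
    qed
    have False if "(x, y) \<in> S" for x y
    proof -
      have "y0 \<le> y" "y \<le> y1" using y0[of y] y1[of y] that by force+
      then have "(x, y) \<in> K a"
        using convex_oblique[OF convex_K[OF a(1)], of x 0 y0 y1 y] line a b True by simp
      then show False using that not_in_S a by blast
    qed
    then have "S = {}" by auto
    then show ?thesis by simp
  next
    case False
    have le: "card low \<le> card I" "card high \<le> card I"
      using finite_I by (auto intro!: card_mono simp: low_def high_def)
    have diff: "card (I - low) = card I - card low" "card (I - high) = card I - card high"
      using fin_lh by (auto intro!: card_Diff_subset simp: low_def high_def)
    have two: "2 \<le> card low" "2 \<le> card high"
      using card_mono[OF fin_lh(1) ab(1)] card_mono[OF fin_lh(2) ab(2)] False by auto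
    show ?thesis
    proof (cases "5 \<le> card low + card high")
      case True
      \<comment> \<open>With n = \<open>card I\<close> the right-hand side is 5n - 2(c_- + c_+), so
        five unbounded ends give the 11.\<close>
      have "card S + 1 \<le> card low + 3 * (card I - card low) + 2 * (card I - card high)"
        using card_S_le ab diff by auto
      then show ?thesis using True le by linarith
    next
      case False
      then have card: "card {a, b} = card low" "card {a, b} = card high" using two \<open>a \<noteq> b\<close> by auto
      have eq: "low = {a, b}" "high = {a, b}"
        using card_subset_eq[OF fin_lh(1) ab(1) card(1)] card_subset_eq[OF fin_lh(2) ab(2) card(2)]
        by (simp_all only:)
      have sub: "pres y0 \<subseteq> {a, b}" "pres y1 \<subseteq> {a, b}"
        by (simp_all only: pres eq order_refl)
      obtain s0 where s0: "\<And>z. z < s0 \<Longrightarrow> (z, y0) \<in> K a" "\<And>z. s0 < z \<Longrightarrow> (z, y0) \<in> K b"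
        using two_sets_on_level[OF sub(1) notin(1) a(1) b(1) \<open>a \<noteq> b\<close> a(2) b(2)] by metis
      obtain s1 where s1: "\<And>z. z < s1 \<Longrightarrow> (z, y1) \<in> K a" "\<And>z. s1 < z \<Longrightarrow> (z, y1) \<in> K b"
        using two_sets_on_level[OF sub(2) notin(2) a(1) b(1) \<open>a \<noteq> b\<close> a(3) b(3)] by metis
      \<comment> \<open>The line through the two split points. That \<open>y0 < y1\<close> is
        derived from a point of \<open>S\<close>; without one the claim is vacuous.\<close>
      define m where "m = (s1 - s0) / (y1 - y0)"
      define c where "c = s0 - m * y0"
      have "x = c + m * y" if S: "(x, y) \<in> S" for x y
      proof -
        have y: "y0 < y" "y < y1" using y0[of y] y1[of y] S by force+
        then have "m * (y1 - y0) = s1 - s0" by (simp add: m_def)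
        then have s: "s0 = c + m * y0" "s1 = c + m * y1" by (auto simp: c_def algebra_simps)
        \<comment> \<open>The horizontal offset from that line. If it is nonzero, the parallel line
          through \<open>(x, y)\<close> meets both extreme levels on the same side of the split
          points, in \<open>K a\<close> or in \<open>K b\<close>.\<close>
        define e where "e = x - (c + m * y)"
        have "(c + e + m * y, y) \<in> K a" if "e < 0"
          using convex_oblique[OF convex_K[OF a(1)], of "c + e" m y0 y1 y]
            s0(1)[of "c + e + m * y0"] s1(1)[of "c + e + m * y1"] s y that by simp
        moreover have "(c + e + m * y, y) \<in> K b" if "e > 0"
          using convex_oblique[OF convex_K[OF b(1)], of "c + e" m y0 y1 y]
            s0(2)[of "c + e + m * y0"] s1(2)[of "c + e + m * y1"] s y that by simp
        moreover have "c + e + m * y = x" by (simp add: e_def)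
        ultimately have "\<not> e < 0" "\<not> e > 0" using not_in_S S a b by metis+
        then show ?thesis by (simp add: e_def)
      qed
      then have "card S \<le> card I" by (rule card_collinear_le)
      then show ?thesis using assms(1) by linarith
    qed
  qed
qed

end

subsection \<open>A generic direction\<close>

text \<open>The shear by \<open>t\<close> makes these rays horizontal; \<open>c\<close> is \<open>1\<close> for right and \<open>-1\<close> for left.\<close>

definition has_ray :: "real \<Rightarrow> real \<Rightarrow> (real \<times> real) set \<Rightarrow> bool" where
  "has_ray c t A \<longleftrightarrow> (\<exists>x y. \<forall>z\<ge>x. (c * z, y - t * (c * z)) \<in> A)"

text \<open>Far out, on the vertical line at \<open>c * N\<close>, the rays for \<open>s\<close> run
  above those for \<open>t\<close>. Both sets then contain the vertical segment between their two
  rays, and for large \<open>N\<close> these segments overlap.\<close>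

lemma two_rays_meet:
  assumes "convex A" "convex B" "has_ray c t A" "has_ray c t B" "has_ray c s A" "has_ray c s B"
    and "(t - s) * c > 0"
  shows "A \<inter> B \<noteq> {}"
proof -
  obtain x1 y1 where 1: "\<And>z. z \<ge> x1 \<Longrightarrow> (c * z, y1 - t * (c * z)) \<in> A"
    using assms(3) by (auto simp: has_ray_def)
  obtain x2 y2 where 2: "\<And>z. z \<ge> x2 \<Longrightarrow> (c * z, y2 - t * (c * z)) \<in> B"
    using assms(4) by (auto simp: has_ray_def)
  obtain x3 y3 where 3: "\<And>z. z \<ge> x3 \<Longrightarrow> (c * z, y3 - s * (c * z)) \<in> A"
    using assms(5) by (auto simp: has_ray_def)
  obtain x4 y4 where 4: "\<And>z. z \<ge> x4 \<Longrightarrow> (c * z, y4 - s * (c * z)) \<in> B"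
    using assms(6) by (auto simp: has_ray_def)
  define M where "M = \<bar>y1\<bar> + \<bar>y2\<bar> + \<bar>y3\<bar> + \<bar>y4\<bar>"
  define N where "N = Max {x1, x2, x3, x4, M / ((t - s) * c)}"
  have N: "x1 \<le> N" "x2 \<le> N" "x3 \<le> N" "x4 \<le> N" "M / ((t - s) * c) \<le> N" by (auto simp: N_def)
  have "M \<le> (t - s) * c * N" using N(5) assms(7) by (simp add: field_simps)
  then have M: "M \<le> t * (c * N) - s * (c * N)" by (simp add: algebra_simps)
  define y where "y = max y1 y2 - t * (c * N)"
  have "y1 - y3 \<le> M" "y2 - y3 \<le> M" "y1 - y4 \<le> M" "y2 - y4 \<le> M"
    using abs_ge_self[of y1] abs_ge_self[of y2] abs_ge_minus_self[of y3] abs_ge_minus_self[of y4]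
      abs_ge_zero[of y1] abs_ge_zero[of y2] abs_ge_zero[of y3] abs_ge_zero[of y4]
    unfolding M_def by linarith+
  then have y: "y1 - t * (c * N) \<le> y" "y \<le> y3 - s * (c * N)"
      "y2 - t * (c * N) \<le> y" "y \<le> y4 - s * (c * N)"
    using M unfolding y_def by linarith+
  have "(c * N, y) \<in> A"
    using convex_oblique[OF assms(1), of "c * N" 0, OF _ _ y(1,2)] 1[OF N(1)] 3[OF N(3)] by simp
  moreover have "(c * N, y) \<in> B"
    using convex_oblique[OF assms(2), of "c * N" 0, OF _ _ y(3,4)] 2[OF N(2)] 4[OF N(4)] by simp
  ultimately show ?thesis by blast
qed

text \<open>Two different parameters satisfy the sign condition of \<open>two_rays_meet\<close> in
  one of the two orders, so there is at most one.\<close>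

lemma finite_common_rays:
  assumes "convex A" "convex B" "A \<inter> B = {}" "c \<noteq> 0"
  shows "finite {t. has_ray c t A \<and> has_ray c t B}" (is "finite ?T")
proof -
  have "t = s" if "t \<in> ?T" "s \<in> ?T" for t s
  proof (rule ccontr)
    assume "t \<noteq> s"
    then have "(t - s) * c \<noteq> 0" using assms(4) by simp
    moreover have "(s - t) * c = - ((t - s) * c)" by (simp add: algebra_simps)
    ultimately have "(t - s) * c > 0 \<or> (s - t) * c > 0" by linarith
    then show False
      using two_rays_meet[OF assms(1,2), of c t s] two_rays_meet[OF assms(1,2), of c s t] that assms(3)
      by blast
  qed
  then have "?T = {} \<or> (\<exists>t. ?T = {t})" by blast
  then show ?thesis by (metis finite.emptyI finite_insert)
qed

text \<open>Levels after the shear are lines of slope \<open>-t\<close> before it, so choosing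
  \<open>t\<close> means choosing the sweep direction.\<close>

definition shear :: "real \<Rightarrow> real \<times> real \<Rightarrow> real \<times> real" where
  "shear t = (\<lambda>(x, y). (x, y + t * x))"

lemma linear_shear: "linear (shear t)"
  by (intro linearI) (auto simp: shear_def algebra_simps)

lemma shear_inverse: "shear (-t) (shear t p) = p" "shear t (shear (-t) p) = p"
  by (auto simp: shear_def split: prod.split)

lemma bij_shear: "bij (shear t)"
  by (rule o_bij[of "shear (-t)"]) (auto simp: fun_eq_iff shear_inverse)

lemma mem_shear_image: "(x, y) \<in> shear t ` A \<longleftrightarrow> (x, y - t * x) \<in> A"
proof -
  have "p \<in> shear t ` A \<longleftrightarrow> shear (-t) p \<in> A" for p
    by (metis image_iff shear_inverse)
  then show ?thesis by (simp add: shear_def)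
qed

lemma card_complement_convex_cover:
  fixes C :: "'i \<Rightarrow> (real \<times> real) set"
  assumes I: "finite I" "3 \<le> card I" and convex: "\<And>i. i \<in> I \<Longrightarrow> convex (C i)"
    and disj: "disjoint_family_on C I" and fin: "finite (UNIV - (\<Union>i\<in>I. C i))"
  shows "card (UNIV - (\<Union>i\<in>I. C i)) \<le> 5 * card I - 11"
proof -
  define S where "S = UNIV - (\<Union>i\<in>I. C i)"
  \<comment> \<open>Bad parameters: \<open>T1\<close> puts two points of \<open>S\<close> on one
    level, and \<open>T2\<close> lets two different sets own left rays, or right rays, possibly on
    different levels.\<close>
  define T1 where "T1 = (\<Union>(p, q)\<in>{(p, q) \<in> S \<times> S. p \<noteq> q}. {t. snd (shear t p) = snd (shear t q)})"
  define T2 where "T2 = (\<Union>(i, j)\<in>{(i, j) \<in> I \<times> I. i \<noteq> j}.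
    {t. has_ray (-1) t (C i) \<and> has_ray (-1) t (C j)} \<union> {t. has_ray 1 t (C i) \<and> has_ray 1 t (C j)})"
  have "finite {t. snd (shear t p) = snd (shear t q)}" if "p \<noteq> q" for p q
  proof -
    have "{t. snd (shear t p) = snd (shear t q)} \<subseteq> {(snd q - snd p) / (fst p - fst q)}"
    proof
      fix t assume "t \<in> {t. snd (shear t p) = snd (shear t q)}"
      then have *: "t * (fst p - fst q) = snd q - snd p"
        by (simp add: shear_def algebra_simps split: prod.splits)
      then have "fst p \<noteq> fst q" using that by (auto simp: prod_eq_iff)
      then show "t \<in> {(snd q - snd p) / (fst p - fst q)}" using * by (simp add: field_simps)
    qed
    then show ?thesis using finite_subset by blast
  qed
  moreover have "finite {(p, q) \<in> S \<times> S. p \<noteq> q}"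
    by (rule finite_subset[of _ "S \<times> S"]) (use fin S_def in auto)
  ultimately have T1: "finite T1" unfolding T1_def by (intro finite_UN_I) auto
  have "finite {t. has_ray c t (C i) \<and> has_ray c t (C j)}" if "i \<in> I" "j \<in> I" "i \<noteq> j" "c \<noteq> 0" for i j c
    using finite_common_rays convex disj that by (auto simp: disjoint_family_on_def)
  moreover have "finite {(i, j) \<in> I \<times> I. i \<noteq> j}"
    by (rule finite_subset[of _ "I \<times> I"]) (use I in auto)
  ultimately have T2: "finite T2" unfolding T2_def by (intro finite_UN_I) auto
  obtain t where t: "t \<notin> T1 \<union> T2"
    using ex_new_if_finite[OF infinite_UNIV_char_0] T1 T2 by (metis finite_Un)
  interpret convex_cover I "\<lambda>i. shear t ` C i" "shear t ` S"
  proof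
    show "finite I" by (rule I(1))
    show "convex (shear t ` C i)" if "i \<in> I" for i
      using convex[OF that] by (rule convex_linear_image[OF linear_shear])
    show "shear t ` C i \<inter> shear t ` C j = {}" if "i \<in> I" "j \<in> I" "i \<noteq> j" for i j
      using that disj by (simp add: image_Int[OF bij_is_inj[OF bij_shear], symmetric] disjoint_family_on_def)
    show "shear t ` S = UNIV - (\<Union>i\<in>I. shear t ` C i)"
      using bij_shear[of t] by (simp add: S_def image_set_diff bij_is_inj bij_is_surj image_UN)
    show "finite (shear t ` S)" using fin by (simp add: S_def)
    show "inj_on snd (shear t ` S)"
    proof (rule inj_onI; elim imageE)
      fix p q p' q' assume "snd p' = snd q'" "p' = shear t p" "q' = shear t q" "p \<in> S" "q \<in> S"
      then show "p' = q'" using t unfolding T1_def by blast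
    qed
  qed
  have left: "has_ray (-1) t (C i)" if i: "left_ray i y" for i y
  proof -
    obtain x where x: "\<And>z. z \<le> x \<Longrightarrow> (z, y - t * z) \<in> C i"
      using i by (auto simp: left_ray_def mem_shear_image)
    show ?thesis unfolding has_ray_def
      by (rule exI[of _ "-x"], rule exI[of _ y]) (use x[of "- z" for z] in auto)
  qed
  have right: "has_ray 1 t (C i)" if i: "right_ray i y" for i y
    using i by (auto simp: right_ray_def mem_shear_image has_ray_def)
  have "card (shear t ` S) \<le> 5 * card I - 11"
  proof (rule card_S_le_generic[OF I(2)])
    have uniq: "i = j" if "i \<in> I" "j \<in> I" "has_ray c t (C i)" "has_ray c t (C j)" "c \<in> {-1, 1}" for i j c
      using t that unfolding T2_def by blast
    show "i = j" if "i \<in> I" "j \<in> I" "left_ray i y" "left_ray j y'" for i j y y'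
      using uniq[of i j "-1"] left that by blast
    show "i = j" if "i \<in> I" "j \<in> I" "right_ray i y" "right_ray j y'" for i j y y'
      using uniq[of i j 1] right that by blast
  qed
  moreover have "card (shear t ` S) = card S"
    by (intro card_image inj_on_subset[OF bij_is_inj[OF bij_shear]]) auto
  ultimately show ?thesis by (simp add: S_def)
qed

subsection \<open>The extremal configuration\<close>

text \<open>A proper convex combination is strictly inside as soon as one of the two points is; if
  both lie on the boundary, convexity of \<open>B\<close> decides.\<close>

lemma convex_half_open:
  assumes "convex (B :: (real \<times> real) set)"
  shows "convex {(x, y). a * x + b * y < c \<or> a * x + b * y = c \<and> (x, y) \<in> B}" (is "convex ?H")
proof (rule convexI)
  fix p q and u v :: real
  assume p: "p \<in> ?H" and q: "q \<in> ?H" and uv: "0 \<le> u" "0 \<le> v" "u + v = 1"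
  define f where "f = (\<lambda>(x, y). a * x + b * y)"
  have H: "r \<in> ?H \<longleftrightarrow> f r < c \<or> f r = c \<and> r \<in> B" for r by (cases r) (simp add: f_def)
  have f: "f (u *\<^sub>R p + v *\<^sub>R q) = u * f p + v * f q"
    by (cases p; cases q) (simp add: f_def algebra_simps)
  have le: "f p \<le> c" "f q \<le> c" using p q H by auto
  have c: "c = u * c + v * c" using uv by (metis distrib_right mult_1)
  show "u *\<^sub>R p + v *\<^sub>R q \<in> ?H"
  proof (cases "u = 0 \<or> v = 0")
    case True
    then show ?thesis using uv p q by auto
  next
    case False
    show ?thesis
    proof (cases "f p = c \<and> f q = c")
      case True
      then have "p \<in> B" "q \<in> B" using p q H by auto
      then have "u *\<^sub>R p + v *\<^sub>R q \<in> B" using convexD[OF assms] uv by blast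
      then show ?thesis using True c f H by simp
    next
      case False
      then have "f p < c \<or> f q < c" using le by auto
      then have "u * f p + v * f q < u * c + v * c"
        using le \<open>\<not> (u = 0 \<or> v = 0)\<close> uv
        by (metis add_le_less_mono add_less_le_mono mult_left_mono mult_strict_left_mono order_le_less)
      then show ?thesis using c f H by simp
    qed
  qed
qed

lemma convex_fst_vimage: "convex X \<Longrightarrow> convex (fst -` X :: (real \<times> real) set)"
  by (intro convex_linear_vimage linear_fst)

lemma convex_half_open_fst:
  fixes X :: "real set"
  assumes "convex X"
  shows "convex {(x, y). a * x + b * y < c \<or> a * x + b * y = c \<and> x \<in> X}"
  using convex_half_open[OF convex_fst_vimage[OF assms], of a b c] by simp

text \<open>\<open>f\<close> is the maximum of the lines \<open>tangent j\<close> (and of \<open>0\<close>), and it agrees with \<open>tangent j\<close>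
  between \<open>j - 1\<close> and \<open>j\<close>. The boundary of the slice \<open>j\<close> on the graph of \<open>f\<close> has its missing point
  at \<open>j - 1/2\<close>; the half before it belongs to the cell outside, the half after it to the slice.
  The last slice \<open>N\<close> is unbounded to the right.\<close>

definition tangent :: "nat \<Rightarrow> real \<Rightarrow> real" where
  "tangent j x = real j * x - real j * (real j - 1) / 2"

text \<open>The lines of \<open>i\<close> and \<open>j\<close> cross at
  \<open>(i + j - 1) / 2\<close>, so neighbouring lines cross at an integer: those of
  \<open>j\<close> and \<open>j + 1\<close> at \<open>j\<close>.\<close>

lemma tangent_diff: "tangent j x - tangent i x = (real j - real i) * (x - (real i + real j - 1) / 2)"
  by (simp add: tangent_def field_simps power2_eq_square)

text \<open>The negative x-axis is the edge between the upper and the lower cell. Its missing point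
  is \<open>(-1, 0)\<close>; the part before it goes to the upper cell, the rest up to the origin to
  the lower one.\<close>

definition upper_cell :: "nat \<Rightarrow> (real \<times> real) set" where
  "upper_cell N = {(x, y). (0 < y \<or> y = 0 \<and> x < -1) \<and>
     (\<forall>j\<in>{1..N}. tangent j x < y \<or> y = tangent j x \<and> real j - 1 < x \<and> x < real j - 1/2)}"

definition lower_cell :: "nat \<Rightarrow> (real \<times> real) set" where
  "lower_cell N = {(x, y). (y < 0 \<or> y = 0 \<and> -1 < x \<and> x < 0) \<and>
     (\<forall>j\<in>{1..N}. tangent j x < -y \<or> -y = tangent j x \<and> real j - 1 < x \<and> x < real j - 1/2)}"

text \<open>On the vertical edge at \<open>x = j\<close> the upper half belongs to slice
  \<open>j\<close>, the lower half to slice \<open>j + 1\<close>, and the midpoint to neither.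
  Strict bounds on \<open>x\<close> along the slanted edges leave out the vertices.\<close>

definition slice :: "nat \<Rightarrow> nat \<Rightarrow> (real \<times> real) set" where
  "slice N j = {(x, y). (real j - 1 < x \<or> x = real j - 1 \<and> y < 0) \<and>
     (j < N \<longrightarrow> x < real j \<or> x = real j \<and> 0 < y) \<and>
     (y < tangent j x \<or> y = tangent j x \<and> real j - 1/2 < x \<and> (j < N \<longrightarrow> x < real j)) \<and>
     (-y < tangent j x \<or> -y = tangent j x \<and> real j - 1/2 < x \<and> (j < N \<longrightarrow> x < real j))}"

lemma convex_upper_cell: "convex (upper_cell N)"
proof -
  define c where "c j = real j * (real j - 1) / 2" for j :: nat
  have line: "tangent j x = real j * x - c j" for j x by (simp add: tangent_def c_def)
  have "upper_cell N = {(x, y). 0 * x + (-1) * y < 0 \<or> 0 * x + (-1) * y = 0 \<and> x \<in> {..< -1}} \<inter>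
    (\<Inter>j\<in>{1..N}. {(x, y). real j * x + (-1) * y < c j \<or>
        real j * x + (-1) * y = c j \<and> x \<in> {real j - 1<..<real j - 1/2}})"
    unfolding upper_cell_def line by (intro set_eqI) (auto simp: algebra_simps)
  also have "convex \<dots>"
    by (intro convex_Int convex_INT convex_half_open_fst convex_real_interval)
  finally show ?thesis .
qed

lemma convex_lower_cell: "convex (lower_cell N)"
proof -
  define c where "c j = real j * (real j - 1) / 2" for j :: nat
  have line: "tangent j x = real j * x - c j" for j x by (simp add: tangent_def c_def)
  have "lower_cell N = {(x, y). 0 * x + 1 * y < 0 \<or> 0 * x + 1 * y = 0 \<and> x \<in> {-1<..<0}} \<inter>
    (\<Inter>j\<in>{1..N}. {(x, y). real j * x + 1 * y < c j \<or>
        real j * x + 1 * y = c j \<and> x \<in> {real j - 1<..<real j - 1/2}})"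
    unfolding lower_cell_def line by (intro set_eqI) (auto simp: algebra_simps)
  also have "convex \<dots>"
    by (intro convex_Int convex_INT convex_half_open_fst convex_real_interval)
  finally show ?thesis .
qed

lemma convex_slice: "convex (slice N j)"
proof -
  define c where "c = real j * (real j - 1) / 2"
  define X where "X = {real j - 1/2<..} \<inter> (if j < N then {..<real j} else UNIV)"
  have "convex X" by (auto simp: X_def intro!: convex_Int convex_real_interval)
  have snd_conv: "convex (snd -` Y)" if "convex Y" for Y :: "real set"
    using that by (intro convex_linear_vimage linear_snd)
  have "slice N j = {(x, y). (-1) * x + 0 * y < 1 - real j \<or> (-1) * x + 0 * y = 1 - real j \<and> (x, y) \<in> snd -` {..<0}} \<inter>
    (if j < N then {(x, y). 1 * x + 0 * y < real j \<or> 1 * x + 0 * y = real j \<and> (x, y) \<in> snd -` {0<..}} else UNIV) \<inter>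
    {(x, y). (- real j) * x + 1 * y < - c \<or> (- real j) * x + 1 * y = - c \<and> x \<in> X} \<inter>
    {(x, y). (- real j) * x + (-1) * y < - c \<or> (- real j) * x + (-1) * y = - c \<and> x \<in> X}"
    unfolding slice_def tangent_def c_def X_def by (intro set_eqI) (auto simp: algebra_simps)
  moreover have "convex (if j < N then {(x, y). 1 * x + 0 * y < real j \<or> 1 * x + 0 * y = real j \<and> (x, y) \<in> snd -` {0<..}} else UNIV)"
    by (simp only: convex_half_open snd_conv convex_real_interval convex_UNIV split: if_split) simp
  ultimately show ?thesis
    by (simp only: convex_Int convex_half_open convex_half_open_fst snd_conv convex_real_interval \<open>convex X\<close>)
qed

lemma upper_lower_disjoint: "upper_cell N \<inter> lower_cell N = {}"
  by (auto simp: upper_cell_def lower_cell_def)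

text \<open>The two can only compete on the common slanted edge, where they use opposite sides of
  \<open>real j - 1/2\<close>.\<close>

lemma upper_slice_disjoint: "j \<in> {1..N} \<Longrightarrow> upper_cell N \<inter> slice N j = {}"
  unfolding upper_cell_def slice_def by fastforce

lemma lower_slice_disjoint: "j \<in> {1..N} \<Longrightarrow> lower_cell N \<inter> slice N j = {}"
  unfolding lower_cell_def slice_def by fastforce

lemma slice_disjoint:
  assumes "i < j" "j \<le> N"
  shows "slice N i \<inter> slice N j = {}"
proof -
  have "i < N" "real i + 1 \<le> real j" using assms by auto
  have False if i: "(x, y) \<in> slice N i" and j: "(x, y) \<in> slice N j" for x y
  proof -
    have "x < real i \<or> x = real i \<and> 0 < y" using i \<open>i < N\<close> by (simp add: slice_def)
    moreover have "real j - 1 < x \<or> x = real j - 1 \<and> y < 0" using j by (simp add: slice_def)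
    ultimately show False using \<open>real i + 1 \<le> real j\<close> by linarith
  qed
  then show ?thesis by auto
qed

text \<open>In order: the missing point of the negative axis and the vertex at the origin, the
  missing points of the slanted edges, those of the vertical edges, and the remaining
  vertices.\<close>

definition gaps :: "nat \<Rightarrow> (real \<times> real) set" where
  "gaps N = {(-1, 0), (0, 0)}
     \<union> (\<lambda>k. (real k - 1/2, tangent k (real k - 1/2))) ` {1..N}
     \<union> (\<lambda>k. (real k - 1/2, - tangent k (real k - 1/2))) ` {1..N}
     \<union> (\<lambda>k. (real k, 0)) ` {1..<N}
     \<union> (\<lambda>k. (real k, tangent k (real k))) ` {1..<N}
     \<union> (\<lambda>k. (real k, - tangent k (real k))) ` {1..<N}"

lemma gapsI:
  "k \<in> {1..N} \<Longrightarrow> (real k - 1/2, tangent k (real k - 1/2)) \<in> gaps N"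
  "k \<in> {1..N} \<Longrightarrow> (real k - 1/2, - tangent k (real k - 1/2)) \<in> gaps N"
  "k \<in> {1..<N} \<Longrightarrow> (real k, 0) \<in> gaps N"
  "k \<in> {1..<N} \<Longrightarrow> (real k, tangent k (real k)) \<in> gaps N"
  "k \<in> {1..<N} \<Longrightarrow> (real k, - tangent k (real k)) \<in> gaps N"
  by (simp_all add: gaps_def)

lemma tangent_mid: "tangent k (real k - 1/2) = (real k)\<^sup>2 / 2"
  by (simp add: tangent_def field_simps power2_eq_square)

lemma tangent_node: "tangent k (real k) = real k * (real k + 1) / 2"
  by (simp add: tangent_def field_simps)

lemma tangent_Suc_node: "tangent (Suc k) (real k) = real k * (real k + 1) / 2"
  by (simp add: tangent_def field_simps)

lemma half_neq: "real k - 1/2 \<noteq> real m"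
proof
  assume "real k - 1/2 = real m"
  then have "real (2 * k) = real (2 * m + 1)" by simp
  then show False by (simp only: of_nat_eq_iff) presburger
qed

lemma finite_gaps: "finite (gaps N)"
  by (simp add: gaps_def)

lemma card_gaps:
  assumes "1 \<le> N"
  shows "card (gaps N) = 5 * N - 1"
proof -
  \<comment> \<open>The sign \<open>s\<close> treats mirror images at once; \<open>B 0\<close> is
    the family on the x-axis.\<close>
  define A where "A s = (\<lambda>k. (real k - 1/2, s * (real k)\<^sup>2 / 2)) ` {1..N}" for s
  define B where "B s = (\<lambda>k. (real k, s * (real k * (real k + 1) / 2))) ` {1..<N}" for s
  have gaps: "gaps N = {(-1, 0), (0, 0)} \<union> A 1 \<union> A (-1) \<union> B 0 \<union> B 1 \<union> B (-1)"
    by (simp add: gaps_def tangent_mid tangent_node A_def B_def)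
  have card: "card (A s) = N" "card (B s) = N - 1" for s
    by (auto simp: A_def B_def card_image inj_on_def)
  have fin: "finite (A s)" "finite (B s)" for s by (auto simp: A_def B_def)
  have 1: "{(-1, 0), (0, 0)} \<inter> A 1 = {}" "({(-1, 0), (0, 0)} \<union> A 1) \<inter> A (-1) = {}"
    using half_neq[of _ 0] by (auto simp: A_def)
  have AB: "A s \<inter> B t = {}" for s t using half_neq by (auto simp: A_def B_def)
  have BB: "B s \<inter> B t = {}" if "s \<noteq> t" for s t using that by (auto simp: B_def)
  have CB: "{(-1, 0), (0, 0)} \<inter> B t = {}" for t by (auto simp: B_def)
  have "card (gaps N) = 2 + N + N + (N - 1) + (N - 1) + (N - 1)"
    unfolding gaps using 1 AB BB CB
    by (subst card_Un_disjoint; (simp add: fin card Int_Un_distrib2)?)+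
  then show ?thesis using assms by simp
qed

text \<open>The abscissa of a gap leaves at most two slices in question, and their edge conditions
  exclude it.\<close>

lemma gaps_uncovered:
  assumes "p \<in> gaps N" "1 \<le> N"
  shows "p \<notin> upper_cell N" "p \<notin> lower_cell N" "j \<in> {1..N} \<Longrightarrow> p \<notin> slice N j"
proof -
  obtain x y where p: "p = (x, y)" by (cases p)
  consider "x = -1" "y = 0" | "x = 0" "y = 0"
    | k where "k \<in> {1..N}" "x = real k - 1/2" "y = tangent k x"
    | k where "k \<in> {1..N}" "x = real k - 1/2" "y = - tangent k x"
    | k where "k \<in> {1..<N}" "x = real k" "y = 0"
    | k where "k \<in> {1..<N}" "x = real k" "y = tangent k x"
    | k where "k \<in> {1..<N}" "x = real k" "y = - tangent k x"
    using assms by (auto simp: gaps_def p)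
  then have "p \<notin> upper_cell N \<and> p \<notin> lower_cell N \<and> (\<forall>j\<in>{1..N}. p \<notin> slice N j)"
  proof cases
    case 1
    then show ?thesis by (auto simp: p upper_cell_def lower_cell_def slice_def)
  next
    case 2
    then show ?thesis by (auto simp: p upper_cell_def lower_cell_def slice_def)
  next
    case 3
    then have "0 < (real k)\<^sup>2" by simp
    moreover have "y = ((real k)\<^sup>2 / 2)" using 3 by (simp add: tangent_mid)
    ultimately have "y > 0" by linarith
    have "p \<notin> upper_cell N" "p \<notin> lower_cell N"
      using 3 \<open>y > 0\<close> by (auto simp: p upper_cell_def lower_cell_def)
    moreover have "p \<notin> slice N j" if j: "j \<in> {1..N}" for j
    proof
      assume p': "p \<in> slice N j"
      then have "real j - 1 < real k - 1/2" using \<open>y > 0\<close> 3 by (auto simp: p slice_def)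
      then have "j \<le> k" by linarith
      moreover have "k \<le> j"
      proof (cases "j < N")
        case True
        then have "real k - 1/2 \<le> real j" using 3 p' by (auto simp: p slice_def)
        then show ?thesis by linarith
      qed (use 3 j in simp)
      ultimately show False using p' 3 by (auto simp: p slice_def)
    qed
    ultimately show ?thesis by blast
  next
    case 4
    then have "0 < (real k)\<^sup>2" by simp
    moreover have "y = - ((real k)\<^sup>2 / 2)" using 4 by (simp add: tangent_mid)
    ultimately have "y < 0" by linarith
    have "p \<notin> upper_cell N" "p \<notin> lower_cell N"
      using 4 \<open>y < 0\<close> by (auto simp: p upper_cell_def lower_cell_def)
    moreover have "p \<notin> slice N j" if j: "j \<in> {1..N}" for j
    proof
      assume p': "p \<in> slice N j"
      then have "real j - 1 \<le> real k - 1/2" using 4 by (auto simp: p slice_def)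
      then have "j \<le> k" by linarith
      moreover have "k \<le> j"
      proof (cases "j < N")
        case True
        then have "real k - 1/2 \<le> real j" using 4 p' by (auto simp: p slice_def)
        then show ?thesis by linarith
      qed (use 4 j in simp)
      ultimately show False using p' 4 by (auto simp: p slice_def)
    qed
    ultimately show ?thesis by blast
  next
    case 5
    then show ?thesis by (auto simp: p upper_cell_def lower_cell_def slice_def)
  next
    case 6
    then have "0 < real k * (real k + 1)" by simp
    moreover have "y = (real k * (real k + 1) / 2)" using 6 by (simp add: tangent_node)
    ultimately have "y > 0" by linarith
    have "p \<notin> upper_cell N" "p \<notin> lower_cell N"
      using 6 \<open>y > 0\<close> by (auto simp: p upper_cell_def lower_cell_def)
    moreover have "p \<notin> slice N j" if j: "j \<in> {1..N}" for j
    proof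
      assume p': "p \<in> slice N j"
      then have "j \<le> k" using \<open>y > 0\<close> 6 by (auto simp: p slice_def)
      moreover have "k \<le> j" using p' 6 j by (cases "j < N") (auto simp: p slice_def)
      ultimately show False using p' 6 by (auto simp: p slice_def)
    qed
    ultimately show ?thesis by blast
  next
    case 7
    then have "0 < real k * (real k + 1)" by simp
    moreover have "y = - (real k * (real k + 1) / 2)" using 7 by (simp add: tangent_node)
    ultimately have "y < 0" by linarith
    have "p \<notin> upper_cell N" "p \<notin> lower_cell N"
      using 7 \<open>y < 0\<close> by (auto simp: p upper_cell_def lower_cell_def)
    moreover have "p \<notin> slice N j" if j: "j \<in> {1..N}" for j
    proof
      assume p': "p \<in> slice N j"
      have "k < j" using p' 7 j \<open>y < 0\<close> by (cases "j < N") (auto simp: p slice_def)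
      moreover have "real j - 1 \<le> real k" using p' 7 by (auto simp: p slice_def)
      \<comment> \<open>For negative \<open>y\<close> only the left edge of slice
        \<open>k + 1\<close> is in question. As both tangents agree at \<open>k\<close>, the vertex
        would lie on the part of the slanted edge before its missing point, which the slice
        lacks.\<close>
      ultimately have "j = Suc k" by linarith
      then show False using p' 7 by (auto simp: p slice_def tangent_node tangent_Suc_node)
    qed
    ultimately show ?thesis by blast
  qed
  then show "p \<notin> upper_cell N" "p \<notin> lower_cell N" "j \<in> {1..N} \<Longrightarrow> p \<notin> slice N j" by blast+
qed

text \<open>The column containing \<open>x\<close> determines the slice, and comparing
  \<open>y\<close> with f(x) and -f(x) decides between upper cell, lower cell and slice; ties are
  points on edges or vertices.\<close>

lemma covered_or_gap:
  assumes "1 \<le> N"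
  shows "p \<in> gaps N \<or> p \<in> upper_cell N \<or> p \<in> lower_cell N \<or> (\<exists>j\<in>{1..N}. p \<in> slice N j)"
proof -
  obtain x y where p: "p = (x, y)" by (cases p)
  have upper: "p \<in> upper_cell N" if "0 < y" "\<And>j. j \<in> {1..N} \<Longrightarrow> tangent j x < y"
    using that by (auto simp: p upper_cell_def)
  have lower: "p \<in> lower_cell N" if "y < 0" "\<And>j. j \<in> {1..N} \<Longrightarrow> tangent j x < -y"
    using that by (auto simp: p lower_cell_def)
  show ?thesis
  proof (cases "x < 0")
    case True
    have neg: "tangent j x < 0" if "j \<in> {1..N}" for j
    proof -
      have "real j * x < 0" "0 \<le> real j * (real j - 1)"
        using that True by (auto simp: mult_pos_neg)
      then show ?thesis by (simp add: tangent_def)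
    qed
    consider "y > 0" | "y < 0" | "y = 0" "x < -1" | "y = 0" "x = -1" | "y = 0" "-1 < x" by linarith
    then show ?thesis
    proof cases
      case 1
      then show ?thesis using upper neg by force
    next
      case 2
      then show ?thesis using lower neg by force
    next
      case 3
      then show ?thesis using neg by (auto simp: p upper_cell_def)
    next
      case 4
      then show ?thesis by (auto simp: p gaps_def)
    next
      case 5
      then show ?thesis using neg True by (auto simp: p lower_cell_def)
    qed
  next
    case False
    define m where "m = nat \<lfloor>x\<rfloor>"
    have m: "real m \<le> x" "x < real m + 1" using False by (simp_all add: m_def)
    \<comment> \<open>The minimum reflects that the last slice has no right edge.\<close>
    define j where "j = min (m + 1) N"
    have j: "j \<in> {1..N}" "real j - 1 \<le> x" "j < N \<Longrightarrow> x < real j"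
    proof -
      show "j \<in> {1..N}" using assms by (auto simp: j_def)
      show "real j - 1 \<le> x" "j < N \<Longrightarrow> x < real j"
        using m by (auto simp: j_def min_def split: if_splits)
    qed
    \<comment> \<open>This is the value f(x): in column \<open>j\<close> no other line is
      higher.\<close>
    define T where "T = tangent j x"
    have bigger: "tangent i x < T" if i: "i \<in> {1..N}" "j < i" for i
    proof -
      have "real j + 1 \<le> real i" "x < real j" using i j by auto
      then have "(real j - real i) * (x - (real i + real j - 1) / 2) > 0"
        by (intro mult_neg_neg) auto
      then show ?thesis unfolding T_def tangent_diff[symmetric] by simp
    qed
    have smaller: "tangent i x \<le> T" if i: "i \<in> {1..N}" "i < j" for i
    proof -
      have "real i + 1 \<le> real j" using i by auto
      then have "(real j - real i) * (x - (real i + real j - 1) / 2) \<ge> 0"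
        using j(2) by (intro mult_nonneg_nonneg) auto
      then show ?thesis unfolding T_def tangent_diff[symmetric] by simp
    qed
    have le_T: "tangent i x \<le> T" if "i \<in> {1..N}" for i
      using bigger[OF that] smaller[OF that] by (cases i j rule: linorder_cases) (auto simp: T_def)
    show ?thesis
    \<comment> \<open>At the left end of the column \<open>tangent j\<close> shares the maximum with
      the preceding line, or with 0 if \<open>j = 1\<close>, so this vertical line is treated
      separately.\<close>
    proof (cases "x = real j - 1")
      case x: False
      then have x: "real j - 1 < x" using j by simp
      have less_T: "tangent i x < T" if "i \<in> {1..N}" "i \<noteq> j" for i
      proof (cases "j < i")
        case False
        then have "real i + 1 \<le> real j" using that by auto
        then have "(real j - real i) * (x - (real i + real j - 1) / 2) > 0"
          using x by (intro mult_pos_pos) auto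
        then show ?thesis unfolding T_def tangent_diff[symmetric] by simp
      qed (use bigger that in blast)
      have "T = real j * (x - (real j - 1) / 2)" by (simp add: T_def tangent_def field_simps)
      moreover have "\<dots> > 0" using x j(1) by (intro mult_pos_pos) auto
      ultimately have T: "T > 0" by simp
      have on_T: "tangent i x < T \<or> T = tangent i x \<and> real i - 1 < x \<and> x < real i - 1/2"
        if "i \<in> {1..N}" "x < real j - 1/2" for i
        using less_T[OF that(1)] that(2) x by (cases "i = j") (auto simp: T_def)
      consider "T < y" | "T < -y" | "y < T" "-y < T" | "y = T \<or> y = -T" by linarith
      then show ?thesis
      proof cases
        case 1
        then show ?thesis using upper T le_T by force
      next
        case 2
        then show ?thesis using lower T le_T by force
      next
        case 3
        then have "p \<in> slice N j" using x j unfolding p slice_def T_def by auto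
        then show ?thesis using j(1) by blast
      next
        case y: 4
        consider "x = real j - 1/2" | "real j - 1/2 < x" | "x < real j - 1/2" by linarith
        then show ?thesis
        proof cases
          case 1
          have "p \<in> gaps N"
            using y gapsI(1)[OF j(1)] gapsI(2)[OF j(1)] unfolding p 1 T_def by metis
          then show ?thesis by blast
        next
          case 2
          then have "p \<in> slice N j" using x j T y unfolding p slice_def T_def by auto
          then show ?thesis using j(1) by blast
        next
          case 3
          then have "y = T \<Longrightarrow> p \<in> upper_cell N" "y = -T \<Longrightarrow> p \<in> lower_cell N"
            unfolding p upper_cell_def lower_cell_def using T on_T by auto
          then show ?thesis using y by blast
        qed
      qed
    next
      case x: True
      define k where "k = j - 1"
      have k: "j = Suc k" "x = real k" using j x by (auto simp: k_def)
      have T: "T = real k * (real k + 1) / 2" unfolding T_def k tangent_Suc_node ..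
      moreover have "0 \<le> real k * (real k + 1)" by simp
      ultimately have "T \<ge> 0" by linarith
      consider "T < y" | "T < -y" | "y = T \<or> y = -T" | "y < T" "-y < T" by linarith
      then show ?thesis
      proof cases
        case 1
        then show ?thesis using upper \<open>T \<ge> 0\<close> le_T by force
      next
        case 2
        then show ?thesis using lower \<open>T \<ge> 0\<close> le_T by force
      next
        case 3
        show ?thesis
        proof (cases "k = 0")
          case True
          then show ?thesis using 3 T k by (auto simp: p gaps_def)
        next
          case False
          then have "k \<in> {1..<N}" using j(1) k by auto
          then have "p \<in> gaps N"
            using 3 gapsI(4)[of k N] gapsI(5)[of k N] unfolding p k(2) T tangent_node by blast
          then show ?thesis by blast
        qed
      next
        case 4
        then have "k \<noteq> 0" using T by (intro notI) simp
        then have kN: "k \<in> {1..<N}" using j(1) k by auto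
        consider "y = 0" | "y < 0" | "y > 0" by linarith
        then show ?thesis
        proof cases
          case 1
          then show ?thesis using gapsI(3)[OF kN] unfolding p k(2) by blast
        next
          case 2
          then have "p \<in> slice N j" using 4 j k unfolding p slice_def T_def by auto
          then show ?thesis using j(1) by blast
        next
          case 3
          then have "p \<in> slice N k" using 4 kN k(2) unfolding p slice_def T by (auto simp: tangent_node)
          then show ?thesis using kN by (intro disjI2 bexI[of _ k]) auto
        qed
      qed
    qed
  qed
qed

text \<open>There are \<open>N = n - 2\<close> slices and two outer cells, and
  \<open>5 * N - 1\<close> is \<open>5 * n - 11\<close>.\<close>

lemma sharp_example:
  assumes "3 \<le> n"
  obtains C :: "nat \<Rightarrow> (real \<times> real) set" where "\<And>i. convex (C i)" "disjoint_family_on C {1..n}"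
    "finite (UNIV - (\<Union>i\<in>{1..n}. C i))" "card (UNIV - (\<Union>i\<in>{1..n}. C i)) = 5 * n - 11"
proof -
  define N where "N = n - 2"
  have N: "1 \<le> N" "n = N + 2" using assms by (auto simp: N_def)
  define C where "C i = (if i \<le> N then slice N i else if i = N + 1 then upper_cell N else lower_cell N)" for i
  have "convex (C i)" for i
    by (auto simp: C_def convex_slice convex_upper_cell convex_lower_cell)
  moreover have "C i \<inter> C j = {}" if "i \<in> {1..n}" "j \<in> {1..n}" "i < j" for i j
    using that upper_lower_disjoint[of N] upper_slice_disjoint[of i N] lower_slice_disjoint[of i N]
      slice_disjoint[of i j N] by (auto simp: C_def N)
  then have "disjoint_family_on C {1..n}"
    unfolding disjoint_family_on_def by (metis Int_commute linorder_neqE_nat)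
  moreover have "UNIV - (\<Union>i\<in>{1..n}. C i) = gaps N"
  proof -
    have "{1..n} = {1..N} \<union> {N + 1, N + 2}" using N by auto
    moreover have slices: "(\<Union>i\<in>{1..N}. C i) = (\<Union>j\<in>{1..N}. slice N j)"
      by (intro SUP_cong) (auto simp: C_def)
    moreover have "C (N + 1) = upper_cell N" "C (N + 2) = lower_cell N" by (simp_all add: C_def)
    ultimately have "(\<Union>i\<in>{1..n}. C i) = (\<Union>j\<in>{1..N}. slice N j) \<union> upper_cell N \<union> lower_cell N"
      by (simp only: UN_Un UN_insert UN_empty Un_empty_right Un_assoc)
    moreover have "p \<in> gaps N \<longleftrightarrow>
        \<not> (p \<in> (\<Union>j\<in>{1..N}. slice N j) \<or> p \<in> upper_cell N \<or> p \<in> lower_cell N)" for p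
      using covered_or_gap[OF N(1), of p] gaps_uncovered[OF _ N(1), of p] by (metis UN_E UN_I)
    ultimately show ?thesis by (intro set_eqI) (simp only: Diff_iff Un_iff UNIV_I simp_thms disj_assoc)
  qed
  ultimately show ?thesis
    using that[of C] card_gaps[OF N(1)] finite_gaps[of N] N by simp
qed

subsection \<open>The bound and its sharpness\<close>

text \<open>This linear bijection transports convexity, disjointness and cardinalities between the
  vector type of the theorem and pairs.\<close>

definition coords :: "real ^ 2 \<Rightarrow> real \<times> real" where
  "coords v = (v $ 1, v $ 2)"

lemma linear_coords: "linear coords"
  by (intro linearI) (auto simp: coords_def)

lemma bij_coords: "bij coords"
  by (rule o_bij[of "\<lambda>(x, y). vector [x, y]"])
    (auto simp: fun_eq_iff coords_def vec_eq_iff forall_2 vector_2)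

theorem proposition1p4:
  fixes n :: nat
  assumes "3 \<le> n"
  shows "(\<forall>K :: nat \<Rightarrow> (real ^ 2) set.
            (\<forall>i\<in>{1..n}. convex (K i)) \<longrightarrow>
            disjoint_family_on K {1..n} \<longrightarrow>
            finite (UNIV - (\<Union>i\<in>{1..n}. K i)) \<longrightarrow>
            card (UNIV - (\<Union>i\<in>{1..n}. K i)) \<le> 5 * n - 11)
       \<and> (\<exists>K :: nat \<Rightarrow> (real ^ 2) set.
            (\<forall>i\<in>{1..n}. convex (K i)) \<and>
            disjoint_family_on K {1..n} \<and>
            finite (UNIV - (\<Union>i\<in>{1..n}. K i)) \<and>
            card (UNIV - (\<Union>i\<in>{1..n}. K i)) = 5 * n - 11)"
proof (intro conjI allI impI)
  fix K :: "nat \<Rightarrow> (real ^ 2) set"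
  assume convex: "\<forall>i\<in>{1..n}. convex (K i)" and disj: "disjoint_family_on K {1..n}"
    and fin: "finite (UNIV - (\<Union>i\<in>{1..n}. K i))"
  have inj: "inj coords" by (rule bij_is_inj[OF bij_coords])
  have eq: "UNIV - (\<Union>i\<in>{1..n}. coords ` K i) = coords ` (UNIV - (\<Union>i\<in>{1..n}. K i))"
    by (simp add: image_set_diff[OF inj] bij_is_surj[OF bij_coords] image_UN)
  have "card (UNIV - (\<Union>i\<in>{1..n}. coords ` K i)) \<le> 5 * card {1..n} - 11"
  proof (rule card_complement_convex_cover)
    show "convex (coords ` K i)" if "i \<in> {1..n}" for i
      using convex that by (intro convex_linear_image linear_coords) blast
    show "disjoint_family_on (\<lambda>i. coords ` K i) {1..n}"
      using disj by (simp add: disjoint_family_on_def image_Int[OF inj, symmetric])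
    show "finite (UNIV - (\<Union>i\<in>{1..n}. coords ` K i))"
      unfolding eq using fin by (rule finite_imageI)
  qed (use assms in auto)
  moreover have "card (coords ` (UNIV - (\<Union>i\<in>{1..n}. K i))) = card (UNIV - (\<Union>i\<in>{1..n}. K i))"
    by (rule card_image[OF inj_on_subset[OF inj subset_UNIV]])
  ultimately show "card (UNIV - (\<Union>i\<in>{1..n}. K i)) \<le> 5 * n - 11"
    unfolding eq by simp
next
  obtain C :: "nat \<Rightarrow> (real \<times> real) set" where C: "\<And>i. convex (C i)" "disjoint_family_on C {1..n}"
    "finite (UNIV - (\<Union>i\<in>{1..n}. C i))" "card (UNIV - (\<Union>i\<in>{1..n}. C i)) = 5 * n - 11"
    using sharp_example[OF assms] by metis
  define K where "K i = coords -` C i" for i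
  have eq: "UNIV - (\<Union>i\<in>{1..n}. K i) = coords -` (UNIV - (\<Union>i\<in>{1..n}. C i))"
    by (auto simp: K_def)
  have "\<forall>i\<in>{1..n}. convex (K i)"
    using C(1) by (auto simp: K_def intro!: convex_linear_vimage linear_coords)
  moreover have "disjoint_family_on K {1..n}"
    using C(2) by (simp add: disjoint_family_on_def K_def vimage_Int[symmetric])
  moreover have "finite (UNIV - (\<Union>i\<in>{1..n}. K i))"
    unfolding eq using C(3) bij_is_inj[OF bij_coords] by (rule finite_vimageI)
  moreover have "card (UNIV - (\<Union>i\<in>{1..n}. K i)) = 5 * n - 11"
    unfolding eq C(4)[symmetric]
    using card_vimage_inj[OF bij_is_inj[OF bij_coords]] bij_is_surj[OF bij_coords] by (metis subset_UNIV)
  ultimately show "\<exists>K :: nat \<Rightarrow> (real ^ 2) set.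
            (\<forall>i\<in>{1..n}. convex (K i)) \<and>
            disjoint_family_on K {1..n} \<and>
            finite (UNIV - (\<Union>i\<in>{1..n}. K i)) \<and>
            card (UNIV - (\<Union>i\<in>{1..n}. K i)) = 5 * n - 11"
    by blast
qed

end
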